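(* Let $w_0,\dots,w_n$ be positive integers and $s=w_0+\cdots+w_n$. Let $\mathcal{M}=D^\hbar/(T_w-q)$ with its basis $P_0,\dots,P_{s-1}$ and its pairing $\langle\!\langle\ ,\ \rangle\!\rangle$, and let $k$, $u_1,\dots,u_k$, $m_1,\dots,m_k$ be the associated data, all as defined in the context. Then for $0\le\alpha,\beta\le s-1$, $$\langle\!\langle P_\alpha,P_\beta\rangle\!\rangle=\begin{cases}\dfrac{1}{m_1}\,\delta_{n-\alpha,\beta} & \text{if } 0\le\alpha<u_1,\\[2mm] \dfrac{1}{m_{i+1}}\,\delta_{s+n-\alpha,\beta} & \text{if } u_1+\cdots+u_i\le\alpha<u_1+\cdots+u_{i+1},\ i\ge1,\end{cases}$$ where $\delta_{a,b}$ (two indices) is the Kronecker delta.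
   Context: Combinatorial data. Let $F=\{\frac{i}{w_j}\mid 0\le i\le w_j-1,\ 0\le j\le n\}=\{f_1,\dots,f_k\}$ with $0=f_1<f_2<\cdots<f_k<f_{k+1}:=1$. Let $S_{f_i}=\{j\in\{0,\dots,n\}\mid w_jf_i\in\mathbb{Z}\}$, and let $u_i$ be the cardinality of $S_{f_i}$ (the multiplicity of $f_i$ in $F$); then $u_1=n+1$ and $u_1+\cdots+u_k=s$. For $1\le i\le k$ put $\Delta_i=f_{i+1}-f_i$ and $m_i=\prod_{j\in S_{f_i}}w_j$; in particular $m_1=w_0\cdots w_n$. For $1\le\alpha\le s$ put $r_\alpha=\frac{1}{m_i}q^{\Delta_i}$ if $\alpha=u_1+\cdots+u_i$ for some $i$, and $r_\alpha=1$ otherwise. The $D$-module. Let $\partial=q\frac{d}{dq}$ and $T_w-q=\prod_{i=0}^n (w_i\hbar\partial)(w_i\hbar\partial-\hbar)\cdots(w_i\hbar\partial-(w_i-1)\hbar)-q$. Let $l$ be the lowest common multiple of $w_0,\dots,w_n$. The coefficient ring $\mathcal{F}$ is the ring of functions of $(q,\hbar)$ which are polynomial in $q^{\pm1/l}$ and holomorphic in $\hbar$ in a neighbourhood of $\hbar=0$. $D^\hbar$ is the ring of ordinary differential operators generated over $\mathcal{F}$ by $\hbar\partial$ (so $\hbar\partial\, f=f\,\hbar\partial+\hbar\, q\frac{\partial f}{\partial q}$ for $f\in\mathcal{F}$), and $(T_w-q)$ is the left ideal generated by $T_w-q$. $\mathcal{M}=D^\hbar/(T_w-q)$ is free of rank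 $s$ over $\mathcal{F}$ with basis $1,\hbar\partial,\dots,(\hbar\partial)^{s-1}$. Another basis is given by the classes of $P_0=1$ and $P_i=\frac{1}{r_i}\hbar\partial P_{i-1}$ for $1\le i\le s-1$. The dual. $\mathcal{M}^*$ is the space of $\mathcal{F}$-module homomorphisms $\pi:\mathcal{M}\to\mathcal{F}$, with $\mathcal{F}$ acting by multiplication and $(\partial\cdot\pi)(P)=-\pi(\partial\cdot P)+q\frac{\partial}{\partial q}\pi(P)$. The $D^\hbar$-module $\bar{\mathcal{M}}^*$ equals $\mathcal{M}^*$ as a set, but with action $\odot$ derived from $\hbar\odot\pi=-\hbar\pi$, $\partial\odot\pi=\partial\cdot\pi$; thus $f(q,\hbar)\odot\pi=f(q,-\hbar)\pi$ for $f\in\mathcal{F}$ and $(\hbar\partial\odot\pi)(P)=\pi(\hbar\partial\cdot P)-\hbar q\frac{\partial}{\partial q}\pi(P)$. Let $\delta_0,\dots,\delta_{s-1}$ (one index) be the basis of $\bar{\mathcal{M}}^*=\mathcal{M}^*$ over $\mathcal{F}$ dual to the basis $1,\hbar\partial,\dots,(\hbar\partial)^{s-1}$ of $\mathcal{M}$. The map $\mathcal{M}\to\bar{\mathcal{M}}^*$, $[P]\mapsto P\odot\delta_n$, is a well-defined isomorphism of $D^\hbar$-modules. The pairing. $\langle\!\langle P,Q\rangle\!\rangle=\frac{1}{w_0\cdots w_n}(P\odot\delta_n)(Q)$ for $P,Q\in\mathcal{M}$. *)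

theory Defs
  imports
    "HOL-Analysis.Analysis"
    "HOL-Library.Poly_Mapping"
    "HOL-Computational_Algebra.Polynomial"
begin

section \<open>Holomorphic germs in h at h = 0\<close>

definition germ_eq :: "(complex \<Rightarrow> complex) \<Rightarrow> (complex \<Rightarrow> complex) \<Rightarrow> bool" where
  "germ_eq f g \<longleftrightarrow> f analytic_on {0} \<and> g analytic_on {0} \<and> (\<forall>\<^sub>F z in nhds 0. f z = g z)"

lemma germ_eq_part_equivp: "part_equivp germ_eq"
proof (rule part_equivpI)
  show "\<exists>f. germ_eq f f"
    by (rule exI[of _ "\<lambda>_. 0"]) (simp add: germ_eq_def)
  show "symp germ_eq"
    by (auto intro!: sympI simp: germ_eq_def eq_commute)
  show "transp germ_eq"
  proof (rule transpI)
    fix f g h assume "germ_eq f g" "germ_eq g h"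
    then show "germ_eq f h"
      unfolding germ_eq_def using eventually_elim2[of "\<lambda>z. f z = g z" "nhds 0" "\<lambda>z. g z = h z"]
      by auto
  qed
qed

quotient_type germ = "complex \<Rightarrow> complex" / partial: germ_eq
  by (rule germ_eq_part_equivp)

instantiation germ :: comm_ring_1
begin

lift_definition zero_germ :: germ is "\<lambda>_. 0" by (simp add: germ_eq_def)
lift_definition one_germ :: germ is "\<lambda>_. 1" by (simp add: germ_eq_def)
lift_definition plus_germ :: "germ \<Rightarrow> germ \<Rightarrow> germ" is "\<lambda>f g z. f z + g z"
  by (auto simp: germ_eq_def intro!: analytic_intros elim: eventually_elim2)
lift_definition minus_germ :: "germ \<Rightarrow> germ \<Rightarrow> germ" is "\<lambda>f g z. f z - g z"
  by (auto simp: germ_eq_def intro!: analytic_intros elim: eventually_elim2)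
lift_definition uminus_germ :: "germ \<Rightarrow> germ" is "\<lambda>f z. - f z"
  by (auto simp: germ_eq_def intro!: analytic_intros elim: eventually_mono)
lift_definition times_germ :: "germ \<Rightarrow> germ \<Rightarrow> germ" is "\<lambda>f g z. f z * g z"
  by (auto simp: germ_eq_def intro!: analytic_intros elim: eventually_elim2)

instance
proof
  show "(0::germ) \<noteq> 1"
    by transfer (auto simp: germ_eq_def dest: eventually_nhds_x_imp_x)
qed (transfer; auto simp: germ_eq_def algebra_simps intro!: analytic_intros)+

end

lift_definition germ_const :: "complex \<Rightarrow> germ" is "\<lambda>c _. c"
  by (simp add: germ_eq_def)

lift_definition germ_id :: germ is "\<lambda>z. z"
  by (simp add: germ_eq_def)

lift_definition germ_reflect :: "germ \<Rightarrow> germ" is "\<lambda>f z. f (- z)"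
proof -
  fix f g :: "complex \<Rightarrow> complex"
  assume "germ_eq f g"
  then have f: "f analytic_on {0}" and g: "g analytic_on {0}"
    and ev: "\<forall>\<^sub>F z in nhds 0. f z = g z"
    by (auto simp: germ_eq_def)
  have *: "(\<lambda>z. f' (- z)) analytic_on {0}" if "f' analytic_on {0}" for f' :: "complex \<Rightarrow> complex"
    using analytic_on_compose_gen[of uminus "{0}" f' "{0}"] that analytic_on_neg[OF analytic_on_ident]
    by (simp add: o_def)
  have "filterlim uminus (nhds 0) (nhds (0 :: complex))"
    using tendsto_minus[of "\<lambda>z::complex. z" 0 "nhds 0"] by (simp add: filterlim_def)
  with ev have "\<forall>\<^sub>F z in nhds 0. f (- z) = g (- z)"
    by (rule eventually_compose_filterlim)
  then show "germ_eq (\<lambda>z. f (- z)) (\<lambda>z. g (- z))"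
    using f g * by (simp add: germ_eq_def)
qed


section \<open>The coefficient ring\<close>

text \<open>
  An element of \<open>coef\<close> is a Laurent polynomial in the formal variable \<open>t = q^(1/l)\<close> whose
  coefficients are germs in \<open>h\<close>; the key \<open>k\<close> stands for \<open>q^(k/l)\<close>. The ring does not depend on
  \<open>l\<close>, but the element \<open>q = t^l\<close> and the derivation \<open>q d/dq\<close> do.
\<close>

type_synonym coef = "int \<Rightarrow>\<^sub>0 germ"

definition cst :: "complex \<Rightarrow> coef" where
  "cst c = Poly_Mapping.single 0 (germ_const c)"

definition hbar :: coef where
  "hbar = Poly_Mapping.single 0 germ_id"

text \<open>The power \<open>q^x\<close>; it is meant for \<open>x\<close> with \<open>l * x\<close> an integer, so the floor does not round.\<close>

definition qpow :: "nat \<Rightarrow> rat \<Rightarrow> coef" where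
  "qpow l x = Poly_Mapping.single \<lfloor>of_nat l * x\<rfloor> 1"

definition qderiv :: "nat \<Rightarrow> coef \<Rightarrow> coef" where
  "qderiv l = Poly_Mapping.mapp (\<lambda>k c. germ_const (of_int k / of_nat l) * c)"

text \<open>\<open>f(q,h)\<close> becomes \<open>f(q,-h)\<close>.\<close>

definition reflect :: "coef \<Rightarrow> coef" where
  "reflect = Poly_Mapping.map germ_reflect"

text \<open>The coefficient ring is not a field; this is the inverse \<open>1/f\<close> for units \<open>f\<close> only.\<close>

definition cinv :: "coef \<Rightarrow> coef" where
  "cinv f = (THE g. f * g = 1)"


section \<open>The ring of differential operators\<close>

text \<open>
  The operator \<open>a\<^sub>0 + a\<^sub>1 (h\<partial>) + a\<^sub>2 (h\<partial>)\<^sup>2 + \<dots>\<close>, coefficients on the left, is represented by the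
  polynomial with coefficients \<open>a\<^sub>j\<close>. Sums are sums of polynomials, but the product is not the
  commutative product of polynomials: it is \<open>dmul\<close>, determined by
  \<open>(h\<partial>) f = f (h\<partial>) + h q (df/dq)\<close>.
\<close>

type_synonym dop = "coef poly"

abbreviation hdel :: dop where
  "hdel \<equiv> [:0, 1:]"

text \<open>Left multiplication by \<open>h\<partial>\<close>.\<close>

definition hdel_left :: "nat \<Rightarrow> dop \<Rightarrow> dop" where
  "hdel_left l Q = pCons 0 Q + map_poly (\<lambda>f. hbar * qderiv l f) Q"

definition dmul :: "nat \<Rightarrow> dop \<Rightarrow> dop \<Rightarrow> dop" where
  "dmul l P Q = (\<Sum>j\<le>degree P. smult (coeff P j) ((hdel_left l ^^ j) Q))"

definition dprod_list :: "nat \<Rightarrow> dop list \<Rightarrow> dop" where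
  "dprod_list l Ps = foldr (dmul l) Ps 1"


lemma qderiv_add: "qderiv l (f + g) = qderiv l f + qderiv l g"
  by (rule poly_mapping_eqI)
    (auto simp: qderiv_def Poly_Mapping.lookup_mapp lookup_add in_keys_iff when_def
      simp flip: distrib_left)

lemma qderiv_0 [simp]: "qderiv l 0 = 0"
  using qderiv_add[of l 0 0] by simp

lemma germ_const_add: "germ_const (a + b) = germ_const a + germ_const b"
  by transfer (simp add: germ_eq_def)

lemma qderiv_single:
  "qderiv l (Poly_Mapping.single k c) = Poly_Mapping.single k (germ_const (of_int k / of_nat l) * c)"
  by (rule poly_mapping_eqI)
    (auto simp: qderiv_def Poly_Mapping.lookup_mapp lookup_single in_keys_iff when_def)

lemma coef_induct [case_names single add]:
  assumes "\<And>k a. P (Poly_Mapping.single k a)" and "\<And>f g. P f \<Longrightarrow> P g \<Longrightarrow> P (f + g)"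
  shows "P (f :: coef)"
proof (induction f rule: update_induct)
  case const
  show ?case
    using assms(1)[of 0 0] by simp
next
  case (update f k a)
  then have "Poly_Mapping.update k a f = f + Poly_Mapping.single k a"
    by (intro poly_mapping_eqI) (auto simp: lookup_update lookup_add lookup_single in_keys_iff when_def)
  then show ?case
    using assms update by simp
qed

lemma qderiv_mult: "qderiv l (f * g) = qderiv l f * g + f * qderiv l g"
proof (induction f rule: coef_induct)
  case (single k a)
  show ?case
  proof (induction g rule: coef_induct)
    case (single j b)
    then show ?case
      by (simp add: qderiv_single mult_single add_divide_distrib germ_const_add
          flip: single_add) (simp add: algebra_simps)
  qed (simp add: qderiv_add algebra_simps)
qed (simp add: qderiv_add algebra_simps)

lemma hdel_left_add: "hdel_left l (P + Q) = hdel_left l P + hdel_left l Q"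
  by (rule poly_eqI)
    (simp add: hdel_left_def coeff_pCons coeff_map_poly qderiv_add algebra_simps split: nat.splits)

lemma hdel_left_0 [simp]: "hdel_left l 0 = 0"
  by (simp add: hdel_left_def)

text \<open>The defining relation of the ring of differential operators.\<close>

lemma hdel_left_smult:
  "hdel_left l (smult f Q) = smult f (hdel_left l Q) + smult (hbar * qderiv l f) Q"
  by (rule poly_eqI)
    (simp add: hdel_left_def coeff_pCons coeff_map_poly qderiv_mult algebra_simps split: nat.splits)

lemma hdel_left_sum: "hdel_left l (sum F A) = (\<Sum>a\<in>A. hdel_left l (F a))"
  by (induction A rule: infinite_finite_induct) (auto simp: hdel_left_add)

lemma smult_sum_right: "smult a (sum F A) = (\<Sum>x\<in>A. smult a (F x))"
  by (induction A rule: infinite_finite_induct) (auto simp: smult_add_right)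

lemma hdel_left_pow_add: "(hdel_left l ^^ j) (P + Q) = (hdel_left l ^^ j) P + (hdel_left l ^^ j) Q"
  by (induction j) (auto simp: hdel_left_add)

lemma dmul_eq_sum:
  assumes "degree P \<le> N"
  shows "dmul l P Q = (\<Sum>j\<le>N. smult (coeff P j) ((hdel_left l ^^ j) Q))"
  unfolding dmul_def using assms
  by (intro sum.mono_neutral_left) (auto simp: coeff_eq_0)

lemma dmul_pCons: "dmul l (pCons a P) Q = smult a Q + dmul l P (hdel_left l Q)"
proof -
  have "dmul l (pCons a P) Q =
    (\<Sum>j\<le>Suc (degree P). smult (coeff (pCons a P) j) ((hdel_left l ^^ j) Q))"
    by (rule dmul_eq_sum) (simp add: degree_pCons_le)
  also have "\<dots> = smult a Q + dmul l P (hdel_left l Q)"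
    by (subst sum.atMost_Suc_shift) (simp add: dmul_def funpow_swap1)
  finally show ?thesis .
qed

lemma dmul_0_left [simp]: "dmul l 0 Q = 0"
  by (simp add: dmul_def)

lemma dmul_add_left: "dmul l (P + P') Q = dmul l P Q + dmul l P' Q"
proof -
  define N where "N = max (degree P) (degree P')"
  have "dmul l (P + P') Q = (\<Sum>j\<le>N. smult (coeff (P + P') j) ((hdel_left l ^^ j) Q))"
    by (rule dmul_eq_sum) (simp add: N_def degree_add_le_max)
  moreover have "dmul l P Q = (\<Sum>j\<le>N. smult (coeff P j) ((hdel_left l ^^ j) Q))"
    by (rule dmul_eq_sum) (simp add: N_def)
  moreover have "dmul l P' Q = (\<Sum>j\<le>N. smult (coeff P' j) ((hdel_left l ^^ j) Q))"
    by (rule dmul_eq_sum) (simp add: N_def)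
  ultimately show ?thesis
    by (simp add: smult_add_left sum.distrib)
qed

lemma dmul_add_right: "dmul l P (Q + Q') = dmul l P Q + dmul l P Q'"
  by (simp add: dmul_def hdel_left_pow_add smult_add_right sum.distrib)

lemma dmul_smult_left: "dmul l (smult a P) Q = smult a (dmul l P Q)"
proof -
  have "dmul l (smult a P) Q = (\<Sum>j\<le>degree P. smult (coeff (smult a P) j) ((hdel_left l ^^ j) Q))"
    by (rule dmul_eq_sum) (simp add: degree_smult_le)
  then show ?thesis
    by (simp add: dmul_def smult_sum_right)
qed

lemma qderiv_1 [simp]: "qderiv l 1 = 0"
  using qderiv_mult[of l 1 1] by simp

lemma dmul_1_left [simp]: "dmul l 1 Q = Q"
  by (simp add: dmul_def)

lemma dmul_hdel: "dmul l hdel Q = hdel_left l Q"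
  by (simp add: dmul_pCons)

lemma dmul_const: "dmul l [:f:] Q = smult f Q"
  by (simp add: dmul_pCons)

lemma hdel_left_monom_1: "hdel_left l (monom 1 j) = monom 1 (Suc j)"
  by (rule poly_eqI)
    (auto simp: hdel_left_def coeff_map_poly coeff_pCons split: nat.splits)

lemma dmul_1_right [simp]: "dmul l P 1 = P"
proof -
  have "(hdel_left l ^^ j) 1 = monom 1 j" for j
    by (induction j) (simp_all add: hdel_left_monom_1 del: monom_Suc)
  then show ?thesis
    by (simp add: dmul_def smult_monom poly_as_sum_of_monoms)
qed

lemma dmul_hdel_left: "dmul l (hdel_left l P) Q = hdel_left l (dmul l P Q)"
proof (induction P arbitrary: Q)
  case (pCons a P)
  have "hdel_left l (pCons a P) = pCons 0 (pCons a P) + pCons (hbar * qderiv l a) (map_poly (\<lambda>f. hbar * qderiv l f) P)"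
    by (simp add: hdel_left_def map_poly_pCons)
  also have "\<dots> = pCons (hbar * qderiv l a) ([:a:] + hdel_left l P)"
    by (simp add: hdel_left_def)
  finally show ?case
    by (simp add: dmul_pCons dmul_add_left pCons hdel_left_add hdel_left_smult algebra_simps)
qed simp

theorem dmul_assoc: "dmul l (dmul l P Q) R = dmul l P (dmul l Q R)"
proof (induction P arbitrary: Q)
  case (pCons a P)
  then show ?case
    by (simp add: dmul_pCons dmul_add_left dmul_smult_left dmul_hdel_left)
qed simp


section \<open>Combinatorial data\<close>

text \<open>The weights are \<open>w 0, \<dots>, w n\<close>; the values of \<open>w\<close> beyond \<open>n\<close> are not used.\<close>

definition wsum :: "(nat \<Rightarrow> nat) \<Rightarrow> nat \<Rightarrow> nat" where
  "wsum w n = (\<Sum>j\<le>n. w j)"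

definition wlcm :: "(nat \<Rightarrow> nat) \<Rightarrow> nat \<Rightarrow> nat" where
  "wlcm w n = Lcm (w ` {..n})"

definition fracs :: "(nat \<Rightarrow> nat) \<Rightarrow> nat \<Rightarrow> rat set" where
  "fracs w n = {of_nat i / of_nat (w j) | i j. i < w j \<and> j \<le> n}"

definition knum :: "(nat \<Rightarrow> nat) \<Rightarrow> nat \<Rightarrow> nat" where
  "knum w n = card (fracs w n)"

text \<open>\<open>fval w n i\<close> is \<open>f\<^sub>i\<close>, with indices \<open>1 \<le> i \<le> k + 1\<close> starting at 1.\<close>

definition fval :: "(nat \<Rightarrow> nat) \<Rightarrow> nat \<Rightarrow> nat \<Rightarrow> rat" where
  "fval w n i = (sorted_list_of_set (fracs w n) @ [1]) ! (i - 1)"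

definition sset :: "(nat \<Rightarrow> nat) \<Rightarrow> nat \<Rightarrow> rat \<Rightarrow> nat set" where
  "sset w n x = {j. j \<le> n \<and> of_nat (w j) * x \<in> \<int>}"

definition umult :: "(nat \<Rightarrow> nat) \<Rightarrow> nat \<Rightarrow> nat \<Rightarrow> nat" where
  "umult w n i = card (sset w n (fval w n i))"

definition fdelta :: "(nat \<Rightarrow> nat) \<Rightarrow> nat \<Rightarrow> nat \<Rightarrow> rat" where
  "fdelta w n i = fval w n (i + 1) - fval w n i"

definition mprod :: "(nat \<Rightarrow> nat) \<Rightarrow> nat \<Rightarrow> nat \<Rightarrow> nat" where
  "mprod w n i = (\<Prod>j\<in>sset w n (fval w n i). w j)"

text \<open>Since every \<open>u\<^sub>i\<close> is positive, there is at most one \<open>i\<close> with \<open>\<alpha> = u\<^sub>1 + \<dots> + u\<^sub>i\<close>.\<close>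

definition rcoef :: "(nat \<Rightarrow> nat) \<Rightarrow> nat \<Rightarrow> nat \<Rightarrow> coef" where
  "rcoef w n \<alpha> =
    (if \<exists>i\<in>{1..knum w n}. \<alpha> = (\<Sum>j=1..i. umult w n j)
     then let i = (THE i. i \<in> {1..knum w n} \<and> \<alpha> = (\<Sum>j=1..i. umult w n j))
          in cst (1 / of_nat (mprod w n i)) * qpow (wlcm w n) (fdelta w n i)
     else 1)"


section \<open>The D-module\<close>

definition Tw_minus_q :: "(nat \<Rightarrow> nat) \<Rightarrow> nat \<Rightarrow> dop" where
  "Tw_minus_q w n =
    dprod_list (wlcm w n)
      [smult (cst (of_nat (w i))) hdel - [:cst (of_nat j) * hbar:].
        i \<leftarrow> [0..<Suc n], j \<leftarrow> [0..<w i]]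
    - [:qpow (wlcm w n) 1:]"

text \<open>Congruence modulo the left ideal generated by \<open>T\<^sub>w - q\<close>.\<close>

definition dcong :: "(nat \<Rightarrow> nat) \<Rightarrow> nat \<Rightarrow> (dop \<times> dop) set" where
  "dcong w n = {(P, Q). \<exists>A. P - Q = dmul (wlcm w n) A (Tw_minus_q w n)}"

definition dcls :: "(nat \<Rightarrow> nat) \<Rightarrow> nat \<Rightarrow> dop \<Rightarrow> dop set" where
  "dcls w n P = dcong w n `` {P}"

definition dmod :: "(nat \<Rightarrow> nat) \<Rightarrow> nat \<Rightarrow> dop set set" where
  "dmod w n = UNIV // dcong w n"

definition madd :: "(nat \<Rightarrow> nat) \<Rightarrow> nat \<Rightarrow> dop set \<Rightarrow> dop set \<Rightarrow> dop set" where
  "madd w n X Y = (\<Union>P\<in>X. \<Union>Q\<in>Y. dcls w n (P + Q))"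

definition mact :: "(nat \<Rightarrow> nat) \<Rightarrow> nat \<Rightarrow> dop \<Rightarrow> dop set \<Rightarrow> dop set" where
  "mact w n A X = (\<Union>P\<in>X. dcls w n (dmul (wlcm w n) A P))"

lemma equiv_dcong: "equiv UNIV (dcong w n)"
proof (rule equivI)
  show "refl (dcong w n)"
    by (auto simp: dcong_def intro!: refl_onI exI[of _ 0])
  show "sym (dcong w n)"
  proof (rule symI)
    fix P Q assume "(P, Q) \<in> dcong w n"
    then obtain A where A: "P - Q = dmul (wlcm w n) A (Tw_minus_q w n)"
      by (auto simp: dcong_def)
    have "Q - P = smult (-1) (P - Q)"
      by simp
    also have "\<dots> = dmul (wlcm w n) (smult (-1) A) (Tw_minus_q w n)"
      unfolding A dmul_smult_left ..
    finally show "(Q, P) \<in> dcong w n"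
      by (auto simp: dcong_def)
  qed
  show "trans (dcong w n)"
  proof (rule transI)
    fix P Q R assume "(P, Q) \<in> dcong w n" "(Q, R) \<in> dcong w n"
    then obtain A B where "P - Q = dmul (wlcm w n) A (Tw_minus_q w n)" "Q - R = dmul (wlcm w n) B (Tw_minus_q w n)"
      by (auto simp: dcong_def)
    then have "P - R = dmul (wlcm w n) (A + B) (Tw_minus_q w n)"
      unfolding dmul_add_left by (metis diff_add_cancel add_diff_eq)
    then show "(P, R) \<in> dcong w n"
      by (auto simp: dcong_def)
  qed
qed simp

lemma dmul_diff_right: "dmul l P (Q - Q') = dmul l P Q - dmul l P Q'"
  using dmul_add_right[of l P "Q - Q'" Q'] by (simp add: algebra_simps)

lemma madd_dcls: "madd w n (dcls w n P) (dcls w n Q) = dcls w n (P + Q)"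
  unfolding madd_def dcls_def
proof (rule UN_equiv_class2[OF equiv_dcong equiv_dcong _ UNIV_I UNIV_I])
  show "congruent2 (dcong w n) (dcong w n) (\<lambda>P Q. dcong w n `` {P + Q})"
  proof (rule congruent2I')
    fix P P' Q Q' assume "(P, P') \<in> dcong w n" "(Q, Q') \<in> dcong w n"
    then obtain A B where "P - P' = dmul (wlcm w n) A (Tw_minus_q w n)" "Q - Q' = dmul (wlcm w n) B (Tw_minus_q w n)"
      by (auto simp: dcong_def)
    then have "(P + Q) - (P' + Q') = dmul (wlcm w n) (A + B) (Tw_minus_q w n)"
      unfolding dmul_add_left by (metis add_diff_add)
    then have "(P + Q, P' + Q') \<in> dcong w n"
      by (auto simp: dcong_def)
    then show "dcong w n `` {P + Q} = dcong w n `` {P' + Q'}"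
      by (rule equiv_class_eq[OF equiv_dcong])
  qed
qed

lemma mact_dcls: "mact w n A (dcls w n P) = dcls w n (dmul (wlcm w n) A P)"
  unfolding mact_def dcls_def
proof (rule UN_equiv_class[OF equiv_dcong _ UNIV_I])
  show "(\<lambda>P. dcong w n `` {dmul (wlcm w n) A P}) respects dcong w n"
  proof (rule congruentI)
    fix P Q assume "(P, Q) \<in> dcong w n"
    then obtain B where "P - Q = dmul (wlcm w n) B (Tw_minus_q w n)"
      by (auto simp: dcong_def)
    then have "dmul (wlcm w n) A P - dmul (wlcm w n) A Q =
        dmul (wlcm w n) (dmul (wlcm w n) A B) (Tw_minus_q w n)"
      by (simp add: dmul_assoc flip: dmul_diff_right)
    then have "(dmul (wlcm w n) A P, dmul (wlcm w n) A Q) \<in> dcong w n"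
      by (auto simp: dcong_def)
    then show "dcong w n `` {dmul (wlcm w n) A P} = dcong w n `` {dmul (wlcm w n) A Q}"
      by (rule equiv_class_eq[OF equiv_dcong])
  qed
qed

primrec Pop :: "(nat \<Rightarrow> nat) \<Rightarrow> nat \<Rightarrow> nat \<Rightarrow> dop" where
  "Pop w n 0 = 1"
| "Pop w n (Suc i) = smult (cinv (rcoef w n (Suc i))) (dmul (wlcm w n) hdel (Pop w n i))"

definition Pbasis :: "(nat \<Rightarrow> nat) \<Rightarrow> nat \<Rightarrow> nat \<Rightarrow> dop set" where
  "Pbasis w n i = dcls w n (Pop w n i)"


section \<open>The dual module and the pairing\<close>

definition mdual :: "(nat \<Rightarrow> nat) \<Rightarrow> nat \<Rightarrow> (dop set \<Rightarrow> coef) set" where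
  "mdual w n = {\<pi> \<in> dmod w n \<rightarrow>\<^sub>E UNIV.
     (\<forall>X\<in>dmod w n. \<forall>Y\<in>dmod w n. \<pi> (madd w n X Y) = \<pi> X + \<pi> Y) \<and>
     (\<forall>f. \<forall>X\<in>dmod w n. \<pi> (mact w n [:f:] X) = f * \<pi> X)}"

text \<open>
  Here \<open>h\<close> acts by \<open>-h\<close>, so coefficients act after \<open>reflect\<close>, and
  \<open>(h\<partial> \<odot> \<pi>)(X) = \<pi>(h\<partial> X) - h q (d/dq) \<pi>(X)\<close>.
\<close>

definition odot_hdel ::
  "(nat \<Rightarrow> nat) \<Rightarrow> nat \<Rightarrow> (dop set \<Rightarrow> coef) \<Rightarrow> (dop set \<Rightarrow> coef)" where
  "odot_hdel w n \<pi> =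
    (\<lambda>X\<in>dmod w n. \<pi> (mact w n hdel X) - hbar * qderiv (wlcm w n) (\<pi> X))"

definition odot ::
  "(nat \<Rightarrow> nat) \<Rightarrow> nat \<Rightarrow> dop \<Rightarrow> (dop set \<Rightarrow> coef) \<Rightarrow> (dop set \<Rightarrow> coef)" where
  "odot w n P \<pi> =
    (\<lambda>X\<in>dmod w n. \<Sum>j\<le>degree P. reflect (coeff P j) * (odot_hdel w n ^^ j) \<pi> X)"

definition ddual :: "(nat \<Rightarrow> nat) \<Rightarrow> nat \<Rightarrow> nat \<Rightarrow> (dop set \<Rightarrow> coef)" where
  "ddual w n i = (THE \<pi>. \<pi> \<in> mdual w n \<and>
     (\<forall>j<wsum w n. \<pi> (dcls w n (monom 1 j)) = (if j = i then 1 else 0)))"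

text \<open>
  The functional \<open>P \<odot> \<delta>\<^sub>n\<close> depends only on the class of \<open>P\<close>; hence the image of a class
  under \<open>P \<mapsto> P \<odot> \<delta>\<^sub>n\<close> is a singleton.
\<close>

definition to_dual :: "(nat \<Rightarrow> nat) \<Rightarrow> nat \<Rightarrow> dop set \<Rightarrow> (dop set \<Rightarrow> coef)" where
  "to_dual w n X = the_elem ((\<lambda>P. odot w n P (ddual w n n)) ` X)"

definition pairing :: "(nat \<Rightarrow> nat) \<Rightarrow> nat \<Rightarrow> dop set \<Rightarrow> dop set \<Rightarrow> coef" where
  "pairing w n X Y = cst (1 / of_nat (\<Prod>j\<le>n. w j)) * to_dual w n X Y"

definition kron :: "int \<Rightarrow> int \<Rightarrow> coef" where
  "kron a b = (if a = b then 1 else 0)"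

end

theory Submission
  imports Defs
begin

text \<open>
  Write \<open>D = h\<partial>\<close>, and let \<open>g \<odot> \<pi>\<close> be the action of an operator \<open>g\<close> on a functional \<open>\<pi>\<close>. The basis
  \<open>P\<^sub>0, P\<^sub>1, \<dots>\<close> is adapted to \<open>D\<close>: by definition \<open>D P\<^sub>a = r\<^sub>a\<^sub>+\<^sub>1 P\<^sub>a\<^sub>+\<^sub>1\<close>. It is even cyclic: \<open>P\<^sub>s\<close> and
  \<open>P\<^sub>0\<close> have the same class. The factors of \<open>T\<^sub>w\<close> have coefficients free of \<open>q\<close>, hence commute, and
  ordering their roots gives \<open>T\<^sub>w = \<Prod>\<^sub>i m\<^sub>i (D - f\<^sub>i h)\<^bsup>u\<^sub>i\<^esup>\<close>. The rule \<open>D q\<^sup>x = q\<^sup>x (D + x h)\<close> shows that the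
  same product arises from \<open>P\<^sub>s\<close> when all powers of \<open>q\<close> are moved to the left (\<open>Pop_U\<close>), so that
  \<open>P\<^sub>s = q\<^sup>-\<^sup>1 T\<^sub>w\<close> and \<open>P\<^sub>s - P\<^sub>0 = q\<^sup>-\<^sup>1 (T\<^sub>w - q)\<close> (\<open>Pop_s\<close>).

  Put \<open>e\<^sub>a = P\<^sub>a \<odot> \<delta>\<^sub>n\<close>. The definition of the dual action turns the cyclic shift into the recursion
  \<open>r\<^sub>a\<^sub>+\<^sub>1 e\<^sub>a\<^sub>+\<^sub>1(P\<^sub>b) = r\<^sub>b\<^sub>+\<^sub>1 e\<^sub>a(P\<^sub>b\<^sub>+\<^sub>1) - h q (d/dq) e\<^sub>a(P\<^sub>b)\<close> (\<open>e_Suc\<close>), starting from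
  \<open>e\<^sub>0(P\<^sub>b) = \<delta>\<^sub>n\<^sub>,\<^sub>b\<close> (\<open>e_0_Pop\<close>). As long as the values are constants the derivative disappears, and
  the only nonzero values are those on the antidiagonals \<open>a + b = n\<close> and \<open>a + b = s + n\<close>. The value
  \<open>c\<^sub>a\<close> in row \<open>a\<close> obeys \<open>r\<^sub>a\<^sub>+\<^sub>1 c\<^sub>a\<^sub>+\<^sub>1 = r\<^sub>b\<^sub>+\<^sub>1 c\<^sub>a\<close> when \<open>b\<close> is the column of the nonzero value in
  row \<open>a + 1\<close>. It is a scalar free of \<open>q\<close> because the set of fractions is
  symmetric under \<open>x \<mapsto> 1 - x\<close> (apart from \<open>0\<close>, which goes to \<open>1\<close>): this symmetry matches the jump of
  \<open>r\<close> at \<open>a + 1 = u\<^sub>1 + \<dots> + u\<^sub>i\<close> with a jump at \<open>b + 1\<close> that has the same power of \<open>q\<close>, while the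
  constants are \<open>1/m\<^sub>i\<close> and \<open>1/m\<^sub>i\<^sub>+\<^sub>1\<close>. So \<open>c\<^sub>a = m\<^sub>1/m\<^sub>i\<^sub>+\<^sub>1\<close> in the block
  \<open>u\<^sub>1 + \<dots> + u\<^sub>i \<le> a < u\<^sub>1 + \<dots> + u\<^sub>i\<^sub>+\<^sub>1\<close> (\<open>e_Pop\<close>). Dividing by \<open>m\<^sub>1 = w\<^sub>0 \<cdots> w\<^sub>n\<close> gives the formula.

  The pairing is defined on classes, so \<open>P \<odot> \<delta>\<^sub>n\<close> must depend only on the class of \<open>P\<close>, that is,
  \<open>(T\<^sub>w - q) \<odot> \<delta>\<^sub>n = 0\<close> (\<open>odot_T\<close>). This comes from the same recursion, run up to the row \<open>a = s\<close>: there it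
  returns to the row \<open>a = 0\<close>, hence \<open>e\<^sub>s = e\<^sub>0\<close> (\<open>e_s\<close>), and \<open>T\<^sub>w - q = q (P\<^sub>s - P\<^sub>0)\<close>. The existence of
  \<open>\<delta>\<^sub>n\<close> itself is division with remainder by \<open>T\<^sub>w - q\<close>, whose leading coefficient is a nonzero
  constant.
\<close>

section \<open>The coefficient ring\<close>

lemma germ_const_mult: "germ_const (a * b) = germ_const a * germ_const b"
  by transfer (simp add: germ_eq_def)

lemma germ_const_0 [simp]: "germ_const 0 = 0"
  by transfer (simp add: germ_eq_def)

lemma germ_const_1 [simp]: "germ_const 1 = 1"
  by transfer (simp add: germ_eq_def)

lemma analytic_reflect:
  assumes "f analytic_on {0}"
  shows "(\<lambda>z::complex. f (- z) :: complex) analytic_on {0}"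
  using analytic_on_compose_gen[of uminus "{0}" f "{0}"] assms
  by (simp add: o_def analytic_on_neg)

lemma germ_reflect_const [simp]: "germ_reflect (germ_const c) = germ_const c"
  by transfer (simp add: germ_eq_def)

lemma germ_reflect_id [simp]: "germ_reflect germ_id = - germ_id"
  by transfer (auto simp: germ_eq_def intro!: analytic_intros)

lemma germ_reflect_add: "germ_reflect (f + g) = germ_reflect f + germ_reflect g"
  by transfer
    (auto simp: germ_eq_def intro!: analytic_on_add analytic_reflect)

lemma germ_reflect_mult: "germ_reflect (f * g) = germ_reflect f * germ_reflect g"
  by transfer
    (auto simp: germ_eq_def intro!: analytic_on_mult analytic_reflect)

lemma germ_reflect_0 [simp]: "germ_reflect 0 = 0"
  using germ_reflect_const[of 0] by simp

lemma germ_reflect_1 [simp]: "germ_reflect 1 = 1"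
  using germ_reflect_const[of 1] by simp

lemma cst_mult: "cst (a * b) = cst a * cst b"
  by (simp add: cst_def mult_single germ_const_mult)

lemma cst_add: "cst (a + b) = cst a + cst b"
  by (simp add: cst_def germ_const_add single_add)

lemma cst_0 [simp]: "cst 0 = 0"
  by (simp add: cst_def)

lemma cst_minus: "cst (- a) = - cst a"
  using cst_add[of a "- a"] by (simp add: eq_neg_iff_add_eq_0 add.commute)

lemma cst_1 [simp]: "cst 1 = 1"
  by (simp add: cst_def)

lemma cst_prod: "cst (prod f A) = (\<Prod>x\<in>A. cst (f x))"
  by (induction A rule: infinite_finite_induct) (auto simp: cst_mult)

lemma qderiv_minus: "qderiv l (- f) = - qderiv l f"
  using qderiv_add[of l f "- f"] by (simp add: eq_neg_iff_add_eq_0 add.commute)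

lemma qderiv_cst [simp]: "qderiv l (cst c) = 0"
  by (simp add: cst_def qderiv_single)

lemma qderiv_hbar [simp]: "qderiv l hbar = 0"
  by (simp add: hbar_def qderiv_single)

lemma qpow_0 [simp]: "qpow l 0 = 1"
  by (simp add: qpow_def)

text \<open>The floor in \<open>qpow\<close> need not be additive unless one of the two exponents is an exact multiple of \<open>1/l\<close>.\<close>

lemma qpow_add:
  assumes "of_nat l * x \<in> \<int>"
  shows "qpow l x * qpow l y = qpow l (x + y)"
  using assms by (auto simp: qpow_def mult_single distrib_left elim!: Ints_cases)

lemma qderiv_qpow:
  assumes "of_nat l * x \<in> \<int>" and "l > 0"
  shows "qderiv l (qpow l x) = cst (of_rat x) * qpow l x"
proof -
  obtain k where k: "of_nat l * x = of_int k"
    using assms(1) by (auto elim: Ints_cases)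
  have "of_nat l * (of_rat x :: complex) = of_int k"
    using arg_cong[OF k, of "of_rat :: rat \<Rightarrow> complex"] by (simp add: of_rat_mult)
  then have "(of_int k / of_nat l :: complex) = of_rat x"
    using assms(2) by (simp add: field_simps)
  then show ?thesis
    by (simp add: qpow_def k qderiv_single cst_def mult_single)
qed

lemma qderiv_sum: "qderiv l (sum f A) = (\<Sum>x\<in>A. qderiv l (f x))"
  by (induction A rule: infinite_finite_induct) (auto simp: qderiv_add)

lemma reflect_single [simp]:
  "reflect (Poly_Mapping.single k c) = Poly_Mapping.single k (germ_reflect c)"
  by (rule poly_mapping_eqI) (auto simp: reflect_def Poly_Mapping.map.rep_eq lookup_single when_def)

lemma reflect_add: "reflect (f + g) = reflect f + reflect g"
  by (rule poly_mapping_eqI)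
    (auto simp: reflect_def Poly_Mapping.map.rep_eq lookup_add when_def
      simp flip: germ_reflect_add)

lemma reflect_mult: "reflect (f * g) = reflect f * reflect g"
proof (induction f rule: coef_induct)
  case (single k a)
  show ?case
    by (induction g rule: coef_induct)
      (simp_all add: mult_single germ_reflect_mult reflect_add distrib_left)
qed (simp add: reflect_add distrib_right)

lemma reflect_0 [simp]: "reflect 0 = 0"
  using reflect_single[of 0 0] by simp

lemma reflect_1 [simp]: "reflect 1 = 1"
  using reflect_single[of 0 1] by simp

lemma reflect_cst [simp]: "reflect (cst c) = cst c"
  by (simp add: cst_def)

lemma reflect_hbar [simp]: "reflect hbar = - hbar"
  by (simp add: hbar_def single_uminus)

lemma reflect_qpow [simp]: "reflect (qpow l x) = qpow l x"
  by (simp add: qpow_def)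

lemma reflect_qderiv: "reflect (qderiv l f) = qderiv l (reflect f)"
  by (induction f rule: coef_induct)
    (simp_all add: qderiv_single germ_reflect_mult reflect_add qderiv_add)

lemma cinv_eqI:
  assumes "f * g = 1"
  shows "cinv f = g"
  unfolding cinv_def
proof (rule the_equality)
  fix g' assume "f * g' = 1"
  then have "g = g * (f * g')"
    by simp
  also have "\<dots> = (f * g) * g'"
    by (simp only: mult.assoc mult.left_commute)
  finally show "g' = g"
    using assms by simp
qed (fact assms)

lemma coeff_hdel_left:
  "coeff (hdel_left l Q) j = coeff (pCons 0 Q) j + hbar * qderiv l (coeff Q j)"
  by (simp add: hdel_left_def coeff_map_poly)

text \<open>Coefficients killed by \<open>q d/dq\<close> commute with \<open>h\<partial>\<close>, so the twisted product is the product of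
  polynomials. This makes the theory of commutative products available for \<open>T\<^sub>w\<close>.\<close>

lemma dmul_eq_mult:
  assumes "\<And>j. qderiv l (coeff Q j) = 0"
  shows "dmul l P Q = P * Q"
proof -
  have "hdel_left l Q' = pCons 0 Q'" if "\<And>j. qderiv l (coeff Q' j) = 0" for Q'
    by (rule poly_eqI) (simp add: coeff_hdel_left that)
  then show ?thesis using assms
  proof (induction P arbitrary: Q)
    case (pCons a P)
    have "\<And>j. qderiv l (coeff (pCons 0 Q) j) = 0"
      by (simp add: coeff_pCons pCons.prems split: nat.splits)
    then show ?case
      using pCons by (simp add: dmul_pCons)
  qed simp
qed

section \<open>The fractions and their reflection\<close>

lemma finite_fracs [simp]: "finite (fracs w n)"
proof -
  have "fracs w n = (\<Union>j\<le>n. (\<lambda>i. of_nat i / of_nat (w j)) ` {..<w j})"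
    by (auto simp: fracs_def)
  then show ?thesis by simp
qed

lemma finite_sset [simp]: "finite (sset w n x)"
  by (rule finite_subset[of _ "{..n}"]) (auto simp: sset_def)

lemma sset_symmetric: "sset w n (1 - x) = sset w n x"
proof -
  have *: "of_nat (w j) * (1 - x) \<in> \<int> \<longleftrightarrow> of_nat (w j) * x \<in> \<int>" for j
  proof -
    have "of_nat (w j) * (1 - x) = of_nat (w j) - of_nat (w j) * x"
      by (simp add: algebra_simps)
    then show ?thesis
      by (metis Ints_diff Ints_of_nat diff_diff_eq2 add_diff_cancel_left')
  qed
  then show ?thesis by (simp add: sset_def)
qed

locale weights =
  fixes w :: "nat \<Rightarrow> nat" and n :: nat
  assumes w_pos: "\<And>j. j \<le> n \<Longrightarrow> w j > 0"
begin

abbreviation "k \<equiv> knum w n"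
abbreviation "s \<equiv> wsum w n"
abbreviation "l \<equiv> wlcm w n"
abbreviation "f \<equiv> fval w n"
abbreviation "u \<equiv> umult w n"
abbreviation "m \<equiv> mprod w n"

text \<open>The breakpoints at which the coefficients \<open>r\<close> jump. With the index \<open>k + 1\<close>, where \<open>f\<^sub>k\<^sub>+\<^sub>1 = 1\<close> has
  multiplicity \<open>n + 1\<close> like \<open>f\<^sub>1 = 0\<close>, the breakpoints are symmetric.\<close>

definition U :: "nat \<Rightarrow> nat" where
  "U i = (\<Sum>j=1..i. u j)"

lemma l_pos: "l > 0"
  using w_pos by (fastforce simp: wlcm_def Lcm_0_iff intro!: Nat.gr0I)

lemma fracs_bounds: "x \<in> fracs w n \<Longrightarrow> 0 \<le> x \<and> x < 1"
  by (auto simp: fracs_def)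

lemma zero_in_fracs: "0 \<in> fracs w n"
  using w_pos[of 0] by (force simp: fracs_def)

lemma one_minus_fracs: "x \<in> fracs w n \<Longrightarrow> x \<noteq> 0 \<Longrightarrow> 1 - x \<in> fracs w n"
proof -
  assume "x \<in> fracs w n" "x \<noteq> 0"
  then obtain i j where ij: "x = of_nat i / of_nat (w j)" "i < w j" "j \<le> n" "i > 0"
    by (fastforce simp: fracs_def)
  then have "1 - x = of_nat (w j - i) / of_nat (w j)" "w j - i < w j"
    by (auto simp: field_simps of_nat_diff)
  then show ?thesis
    using ij(3) unfolding fracs_def by blast
qed

lemma k_pos: "k > 0"
  using zero_in_fracs by (auto simp: knum_def card_gt_0_iff)

abbreviation fseq :: "rat list" where
  "fseq \<equiv> sorted_list_of_set (fracs w n) @ [1]"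

lemma length_fseq: "length fseq = Suc k"
  by (simp add: knum_def)

lemma strict_sorted_fseq: "sorted_wrt (<) fseq"
  using fracs_bounds by (auto simp: sorted_wrt_append)

lemma f_eq: "f i = fseq ! (i - 1)"
  by (simp add: fval_def)

lemma f_last: "f (k + 1) = 1"
  by (simp add: fval_def nth_append knum_def)

lemma bij_f: "bij_betw f {1..k} (fracs w n)"
proof -
  have "bij_betw (nth (sorted_list_of_set (fracs w n))) {..<k} (fracs w n)"
    by (rule bij_betw_nth) (auto simp: knum_def)
  moreover have "bij_betw (\<lambda>i. i - 1) {1..k} {..<k}"
    by (rule bij_betw_byWitness[of _ Suc]) auto
  ultimately have "bij_betw (nth (sorted_list_of_set (fracs w n)) \<circ> (\<lambda>i. i - 1)) {1..k} (fracs w n)"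
    by (rule bij_betw_trans[rotated])
  then show ?thesis
    by (rule bij_betw_cong[THEN iffD1, rotated])
      (auto simp: fval_def nth_append knum_def)
qed

lemma f_in_fracs: "1 \<le> i \<Longrightarrow> i \<le> k \<Longrightarrow> f i \<in> fracs w n"
  using bij_f by (auto simp: bij_betw_def)

text \<open>The map \<open>x \<mapsto> 1 - x\<close> permutes the fractions together with \<open>1\<close> and reverses their order. A strictly
  increasing list is determined by its elements, so reversing and reflecting it changes nothing.\<close>

lemma f_symmetric:
  assumes "1 \<le> i" "i \<le> k + 1"
  shows "f (k + 2 - i) = 1 - f i"
proof -
  let ?R = "rev (map (\<lambda>x. 1 - x) fseq)"
  have "sorted_wrt (<) ?R"
    using strict_sorted_fseq fracs_bounds by (simp add: sorted_wrt_rev sorted_wrt_map sorted_wrt_append)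
  moreover have "set ?R = set fseq"
  proof -
    have "(\<lambda>x. 1 - x) ` insert 1 (fracs w n) = insert 1 (fracs w n)"
    proof -
      have *: "(\<lambda>x. 1 - x) ` insert 1 (fracs w n) \<subseteq> insert 1 (fracs w n)"
        using zero_in_fracs by (auto intro: one_minus_fracs)
      show ?thesis
      proof (rule antisym[OF *])
        show "insert 1 (fracs w n) \<subseteq> (\<lambda>x. 1 - x) ` insert 1 (fracs w n)"
          using image_mono[OF *, of "\<lambda>x. 1 - x"] by (simp add: image_image)
      qed
    qed
    then show ?thesis by simp
  qed
  ultimately have "?R = fseq"
    using strict_sorted_fseq by (metis strict_sorted_equal)
  then have "fseq ! (k + 1 - i) = ?R ! (k + 1 - i)"
    by simp
  also have "\<dots> = 1 - fseq ! (i - 1)"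
  proof -
    have "rev (map (\<lambda>x. 1 - x) xs) ! (k + 1 - i) = 1 - xs ! (i - 1)"
      if "length xs = Suc k" for xs :: "rat list"
      using assms that by (simp add: rev_nth)
    then show ?thesis
      using length_fseq by blast
  qed
  finally show ?thesis
    by (simp add: f_eq)
qed

lemma f_first: "f 1 = 0"
  using f_symmetric[of "k + 1"] f_last by simp

lemma l_f_Ints: "1 \<le> i \<Longrightarrow> i \<le> k + 1 \<Longrightarrow> of_nat l * f i \<in> \<int>"
proof (cases "i = k + 1")
  case False
  moreover assume "1 \<le> i" "i \<le> k + 1"
  ultimately obtain a j where "f i = of_nat a / of_nat (w j)" "j \<le> n"
    using f_in_fracs[of i] by (auto simp: fracs_def)
  moreover obtain c where "l = w j * c"
    using \<open>j \<le> n\<close> by (metis dvdE dvd_Lcm atMost_iff imageI wlcm_def)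
  ultimately have "of_nat l * f i = of_nat (c * a)"
    using w_pos[of j] by simp
  then show ?thesis by simp
qed (use f_last in simp)

lemma sset_zero: "sset w n 0 = {..n}"
  by (auto simp: sset_def)

lemma sset_one: "sset w n 1 = {..n}"
  by (auto simp: sset_def)

lemma u_first: "u 1 = n + 1"
  by (simp only: umult_def f_first sset_zero card_atMost Suc_eq_plus1)

lemma m_first: "m 1 = (\<Prod>j\<le>n. w j)"
  by (simp only: mprod_def f_first sset_zero)

lemma u_last: "u (k + 1) = n + 1"
  using f_last by (simp add: umult_def sset_one)

lemma u_symmetric: "1 \<le> i \<Longrightarrow> i \<le> k + 1 \<Longrightarrow> u (k + 2 - i) = u i"
  by (simp add: umult_def f_symmetric sset_symmetric del: add_2_eq_Suc')

lemma m_symmetric: "1 \<le> i \<Longrightarrow> i \<le> k + 1 \<Longrightarrow> m (k + 2 - i) = m i"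
  by (simp add: mprod_def f_symmetric sset_symmetric del: add_2_eq_Suc')

lemma m_pos: "m i > 0"
  using w_pos by (auto simp: mprod_def sset_def intro!: prod_pos)

lemma fdelta_symmetric:
  assumes "1 \<le> i" "i \<le> k"
  shows "fdelta w n (k + 1 - i) = fdelta w n i"
  using f_symmetric[of i] f_symmetric[of "i + 1"] assms
  by (simp add: fdelta_def Suc_diff_le)

lemma u_pos:
  assumes "1 \<le> i" "i \<le> k + 1"
  shows "u i > 0"
proof (cases "i = k + 1")
  case False
  then obtain a j where "f i = of_nat a / of_nat (w j)" "j \<le> n"
    using f_in_fracs[of i] assms by (auto simp: fracs_def)
  then have "j \<in> sset w n (f i)"
    using w_pos[of j] by (simp add: sset_def)
  then show ?thesis
    by (auto simp: umult_def card_gt_0_iff)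
qed (use u_last in simp)

lemma U_0 [simp]: "U 0 = 0"
  by (simp add: U_def)

lemma U_Suc: "U (Suc i) = U i + u (Suc i)"
  by (simp add: U_def)

lemma bij_numerators:
  assumes "j \<le> n"
  shows "bij_betw (\<lambda>i. of_nat i / of_nat (w j)) {..<w j}
           {x \<in> fracs w n. of_nat (w j) * x \<in> \<int>}"
  unfolding bij_betw_def
proof
  have wj: "w j > 0" using w_pos assms by simp
  then show "inj_on (\<lambda>i. of_nat i / of_nat (w j) :: rat) {..<w j}"
    by (auto simp: inj_on_def)
  show "(\<lambda>i. of_nat i / of_nat (w j)) ` {..<w j} = {x \<in> fracs w n. of_nat (w j) * x \<in> \<int>}"
  proof (intro equalityI subsetI)
    fix x assume "x \<in> {x \<in> fracs w n. of_nat (w j) * x \<in> \<int>}"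
    then obtain a where a: "of_nat (w j) * x = of_int a" and x: "0 \<le> x" "x < 1"
      using fracs_bounds by (auto elim: Ints_cases)
    have "(0::rat) \<le> of_int a"
      using x by (simp flip: a)
    moreover have "(of_int a :: rat) < of_nat (w j)"
      using x wj by (simp flip: a)
    ultimately have "0 \<le> a" "nat a < w j"
      by linarith+
    moreover from \<open>0 \<le> a\<close> have "x = of_nat (nat a) / of_nat (w j)"
      using a wj by (simp add: field_simps)
    ultimately show "x \<in> (\<lambda>i. of_nat i / of_nat (w j)) ` {..<w j}"
      by blast
  qed (use assms wj in \<open>auto simp: fracs_def\<close>)
qed

text \<open>Both sides run over the pairs of an index \<open>j\<close> and a fraction \<open>x\<close> with \<open>w\<^sub>j x\<close> an integer: on the left
  sorted by the index, on the right by the fraction.\<close>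

lemma prod_over_fracs:
  "(\<Prod>j\<le>n. \<Prod>i<w j. g j (of_nat i / of_nat (w j))) = (\<Prod>i=1..k. \<Prod>j\<in>sset w n (f i). g j (f i))"
  for g :: "nat \<Rightarrow> rat \<Rightarrow> 'a :: comm_monoid_mult"
proof -
  have "(\<Prod>j\<le>n. \<Prod>i<w j. g j (of_nat i / of_nat (w j))) =
      (\<Prod>j\<le>n. \<Prod>x\<in>{x \<in> fracs w n. of_nat (w j) * x \<in> \<int>}. g j x)"
    by (intro prod.cong refl prod.reindex_bij_betw bij_numerators) simp
  also have "\<dots> = (\<Prod>x\<in>fracs w n. \<Prod>j\<in>{j \<in> {..n}. of_nat (w j) * x \<in> \<int>}. g j x)"
    by (rule prod.swap_restrict) auto
  also have "\<dots> = (\<Prod>x\<in>fracs w n. \<Prod>j\<in>sset w n x. g j x)"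
    by (simp add: sset_def)
  also have "\<dots> = (\<Prod>i=1..k. \<Prod>j\<in>sset w n (f i). g j (f i))"
    by (rule prod.reindex_bij_betw[OF bij_f, symmetric])
  finally show ?thesis .
qed

lemma U_k: "U k = s"
proof -
  \<comment> \<open>Exponents of 2 turn the product identity into the identity of sums that counts the pairs.\<close>
  have "2 ^ U k = (\<Prod>i=1..k. \<Prod>j\<in>sset w n (f i). 2 :: nat)"
    by (simp add: U_def umult_def power_sum)
  also have "\<dots> = (\<Prod>j\<le>n. \<Prod>i<w j. 2)"
    by (rule prod_over_fracs[symmetric])
  also have "\<dots> = 2 ^ s"
    by (simp add: wsum_def power_sum)
  finally show ?thesis by simp
qed

text \<open>Reflection exchanges the block of \<open>f\<^sub>i\<close> with that of \<open>f\<^sub>k\<^sub>+\<^sub>2\<^sub>-\<^sub>i\<close>, so the breakpoints add up in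
  pairs to \<open>U (k + 1)\<close>.\<close>

lemma U_reflect: "i \<le> k + 1 \<Longrightarrow> U i + U (k + 1 - i) = s + n + 1"
proof (induction i)
  case 0
  then show ?case using U_Suc[of k] U_k u_last by simp
next
  case (Suc i)
  have "U (k + 1 - i) = U (k - i) + u (k + 1 - i)"
    using U_Suc[of "k - i"] Suc.prems by (simp add: Suc_diff_le)
  moreover have "u (k + 1 - i) = u (Suc i)"
    using u_symmetric[of "Suc i"] Suc.prems by simp
  ultimately show ?case
    using Suc by (simp add: U_Suc)
qed

lemma U_strict_mono: "i < j \<Longrightarrow> j \<le> k + 1 \<Longrightarrow> U i < U j"
proof (induction j)
  case (Suc j)
  then show ?case
    using u_pos[of "Suc j"] by (cases "i = j") (auto simp: U_Suc)
qed simp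

lemma U_mono: "i \<le> j \<Longrightarrow> j \<le> k + 1 \<Longrightarrow> U i \<le> U j"
  using U_strict_mono[of i j] by (cases "i = j") auto

lemma U_inj: "i \<le> k + 1 \<Longrightarrow> j \<le> k + 1 \<Longrightarrow> U i = U j \<Longrightarrow> i = j"
  using U_strict_mono[of i j] U_strict_mono[of j i] by (cases i j rule: linorder_cases) auto

lemma U_1: "U 1 = n + 1"
  by (simp add: U_Suc u_first[unfolded One_nat_def])

lemma n_less_s: "n < s"
  using U_mono[of 1 k] k_pos U_1 U_k by simp

lemma rcoef_U:
  assumes "1 \<le> i" "i \<le> k"
  shows "rcoef w n (U i) = cst (1 / of_nat (m i)) * qpow l (fdelta w n i)"
proof -
  have "(THE j. j \<in> {1..k} \<and> U i = U j) = i"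
    using assms U_inj by (intro the_equality) auto
  moreover have "\<exists>j\<in>{1..k}. U i = U j"
    using assms by auto
  ultimately show ?thesis
    unfolding rcoef_def U_def[symmetric] by (simp only: if_True Let_def)
qed

lemma rcoef_other:
  assumes "\<And>i. 1 \<le> i \<Longrightarrow> i \<le> k \<Longrightarrow> a \<noteq> U i"
  shows "rcoef w n a = 1"
  using assms by (auto simp: rcoef_def U_def)

lemma rcoef_inside:
  assumes "i \<le> k" "U i < a" "a < U (Suc i)"
  shows "rcoef w n a = 1"
proof (rule rcoef_other)
  fix j assume "1 \<le> j" "j \<le> k"
  then show "a \<noteq> U j"
    using assms U_mono[of j i] U_mono[of "Suc i" j] by (cases "j \<le> i") auto
qed

lemma l_fdelta_Ints: "1 \<le> i \<Longrightarrow> i \<le> k \<Longrightarrow> of_nat l * fdelta w n i \<in> \<int>"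
  using l_f_Ints[of i] l_f_Ints[of "i + 1"] by (simp add: fdelta_def right_diff_distrib)

text \<open>Division by \<open>r\<close> in the definition of the basis is harmless: each \<open>r\<close> is a nonzero constant times a power of \<open>q\<close>.\<close>

lemma rcoef_unit: "rcoef w n a * cinv (rcoef w n a) = 1"
proof (cases "\<exists>i. 1 \<le> i \<and> i \<le> k \<and> a = U i")
  case True
  then obtain i where i: "1 \<le> i" "i \<le> k" "a = U i" by blast
  let ?g = "cst (of_nat (m i)) * qpow l (- fdelta w n i)"
  have "rcoef w n a * ?g = cst (1 / of_nat (m i) * of_nat (m i)) *
      (qpow l (fdelta w n i) * qpow l (- fdelta w n i))"
    by (simp only: i(3) rcoef_U[OF i(1,2)] cst_mult mult_ac)
  also have "\<dots> = 1"
    using m_pos[of i] l_fdelta_Ints[OF i(1,2)] by (simp add: qpow_add)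
  finally show ?thesis
    using cinv_eqI by metis
next
  case False
  then have "rcoef w n a = 1" by (intro rcoef_other) auto
  then show ?thesis using cinv_eqI[of 1 1] by simp
qed

lemma rcoef_cancel:
  assumes "rcoef w n a * x = rcoef w n a * y"
  shows "x = y"
proof -
  have "(rcoef w n a * cinv (rcoef w n a)) * x = cinv (rcoef w n a) * (rcoef w n a * x)" for x
    by (simp only: mult_ac)
  then show ?thesis
    using assms by (metis rcoef_unit mult_1_left)
qed

lemma cinv_rcoef_U:
  assumes "1 \<le> i" "i \<le> k"
  shows "cinv (rcoef w n (U i)) = cst (of_nat (m i)) * qpow l (f i - f (i + 1))"
proof (rule cinv_eqI)
  have "rcoef w n (U i) * (cst (of_nat (m i)) * qpow l (f i - f (i + 1))) =
      cst (1 / of_nat (m i) * of_nat (m i)) * (qpow l (fdelta w n i) * qpow l (f i - f (i + 1)))"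
    by (simp only: rcoef_U[OF assms] cst_mult mult_ac)
  also have "\<dots> = 1"
    using m_pos[of i] l_fdelta_Ints[OF assms] by (simp add: qpow_add) (simp add: fdelta_def)
  finally show "rcoef w n (U i) * (cst (of_nat (m i)) * qpow l (f i - f (i + 1))) = 1" .
qed

lemma reflect_rcoef: "reflect (rcoef w n a) = rcoef w n a"
proof (cases "\<exists>i. 1 \<le> i \<and> i \<le> k \<and> a = U i")
  case True
  then show ?thesis by (auto simp: rcoef_U reflect_mult)
next
  case False
  then have "rcoef w n a = 1" by (intro rcoef_other) auto
  then show ?thesis by simp
qed

end

section \<open>Closed forms of the differential operators\<close>

text \<open>The operators with coefficients free of \<open>q\<close> form a commutative subring, in which \<open>dmul\<close> is ordinary multiplication.\<close>

definition qconst :: "nat \<Rightarrow> dop \<Rightarrow> bool" where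
  "qconst l Q \<longleftrightarrow> (\<forall>j. qderiv l (coeff Q j) = 0)"

lemma qconst_mult: "qconst l P \<Longrightarrow> qconst l Q \<Longrightarrow> qconst l (P * Q)"
  by (simp add: qconst_def coeff_mult qderiv_sum qderiv_mult)

lemma qconst_1: "qconst l 1"
  by (simp add: qconst_def coeff_1)

lemma qconst_power: "qconst l P \<Longrightarrow> qconst l (P ^ a)"
  by (induction a) (auto simp: qconst_1 qconst_mult)

lemma qconst_prod: "(\<And>x. x \<in> A \<Longrightarrow> qconst l (g x)) \<Longrightarrow> qconst l (prod g A)"
  by (induction A rule: infinite_finite_induct) (auto simp: qconst_1 qconst_mult)

lemma qconst_prod_list: "(\<And>P. P \<in> set Ps \<Longrightarrow> qconst l P) \<Longrightarrow> qconst l (prod_list Ps)"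
  by (induction Ps) (auto simp: qconst_1 qconst_mult)

lemma dprod_list_eq_prod_list:
  "(\<And>P. P \<in> set Ps \<Longrightarrow> qconst l P) \<Longrightarrow> dprod_list l Ps = prod_list Ps"
proof (induction Ps)
  case (Cons P Ps)
  then show ?case
    using qconst_prod_list[of Ps l] by (simp add: dprod_list_def dmul_eq_mult qconst_def)
qed (simp add: dprod_list_def)

lemma prod_list_comprehension:
  "prod_list [g i j. i \<leftarrow> [0..<N], j \<leftarrow> [0..<v i]] = (\<Prod>i<N. \<Prod>j<v i. g i j)"
proof (induction N)
  case (Suc N)
  have "prod_list (map (g N) [0..<M]) = (\<Prod>j<M. g N j)" for M
    by (induction M) auto
  with Suc show ?case by simp
qed simp

text \<open>The operator \<open>h\<partial> - x h\<close>.\<close>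

definition dlin :: "rat \<Rightarrow> dop" where
  "dlin x = [:- cst (of_rat x) * hbar, 1:]"

lemma qconst_smult_dlin: "qconst l (smult (cst c) (dlin x))"
  by (simp add: qconst_def dlin_def coeff_pCons qderiv_mult qderiv_minus split: nat.split)

lemma qconst_dlin: "qconst l (dlin x)"
  using qconst_smult_dlin[of l 1] by simp

text \<open>The commutation rule \<open>(h\<partial>) q\<^sup>-\<^sup>x = q\<^sup>-\<^sup>x (h\<partial> - x h)\<close>: moving a power of \<open>q\<close> to the left shifts the root
  of a linear factor.\<close>

lemma hdel_left_qpow_smult:
  assumes "of_nat l * x \<in> \<int>" "l > 0" "qconst l Q"
  shows "hdel_left l (smult (cst c * qpow l (- x)) Q) = smult (cst c * qpow l (- x)) (dlin x * Q)"
proof -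
  have "qderiv l (qpow l (- x)) = cst (of_rat (- x)) * qpow l (- x)"
    using assms(1,2) by (intro qderiv_qpow) auto
  then have "qderiv l (cst c * qpow l (- x)) = - cst (of_rat x) * (cst c * qpow l (- x))"
    by (simp add: qderiv_mult of_rat_minus cst_minus mult_ac)
  moreover have "hdel_left l Q = pCons 0 Q"
    using assms(3) by (intro poly_eqI) (simp add: coeff_hdel_left qconst_def)
  ultimately show ?thesis
    by (simp only: hdel_left_smult dlin_def mult_pCons_left smult_add_right smult_smult)
      (simp add: mult_ac)
qed

context weights
begin

abbreviation "T \<equiv> Tw_minus_q w n"

text \<open>Each factor \<open>w\<^sub>i h\<partial> - j h\<close> is \<open>w\<^sub>i (h\<partial> - x h)\<close> with \<open>x = j/w\<^sub>i\<close>; collecting the factors by their root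
  \<open>x\<close> gives one block for each fraction, with constant \<open>m\<close> and multiplicity \<open>u\<close>.\<close>

lemma T_eq: "T = smult (cst (of_nat (\<Prod>i=1..k. m i))) (\<Prod>i=1..k. dlin (f i) ^ u i) - [:qpow l 1:]"
proof -
  let ?g = "\<lambda>j x. smult (cst (of_nat (w j))) (dlin x)"
  have factor: "smult (cst (of_nat (w i))) hdel - [:cst (of_nat j) * hbar:]
      = ?g i (of_nat j / of_nat (w i))" if "i \<le> n" for i j
  proof -
    have "(of_nat (w i) * of_rat (of_nat j / of_nat (w i)) :: complex) = of_nat j"
      using w_pos[OF that] by (simp add: of_rat_divide)
    then show ?thesis
      by (simp add: dlin_def flip: cst_mult mult.assoc)
  qed
  have "dprod_list l [smult (cst (of_nat (w i))) hdel - [:cst (of_nat j) * hbar:].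
        i \<leftarrow> [0..<Suc n], j \<leftarrow> [0..<w i]] =
      dprod_list l [?g i (of_nat j / of_nat (w i)). i \<leftarrow> [0..<Suc n], j \<leftarrow> [0..<w i]]"
    using factor by (intro arg_cong[of _ _ "dprod_list l"] arg_cong[of _ _ concat] map_cong refl) auto
  also have "\<dots> = prod_list [?g i (of_nat j / of_nat (w i)). i \<leftarrow> [0..<Suc n], j \<leftarrow> [0..<w i]]"
    by (rule dprod_list_eq_prod_list) (auto simp: qconst_smult_dlin)
  also have "\<dots> = (\<Prod>i\<le>n. \<Prod>j<w i. ?g i (of_nat j / of_nat (w i)))"
    by (simp only: prod_list_comprehension lessThan_Suc_atMost)
  also have "\<dots> = (\<Prod>i=1..k. \<Prod>j\<in>sset w n (f i). ?g j (f i))"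
    by (rule prod_over_fracs)
  also have "\<dots> = (\<Prod>i=1..k. smult (cst (of_nat (m i))) (dlin (f i) ^ u i))"
    by (simp add: prod_smult mprod_def umult_def cst_prod)
  also have "\<dots> = smult (cst (of_nat (\<Prod>i=1..k. m i))) (\<Prod>i=1..k. dlin (f i) ^ u i)"
    by (simp add: prod_smult cst_prod)
  finally show ?thesis
    by (simp only: Tw_minus_q_def)
qed

text \<open>Inside a block every step multiplies by the same factor \<open>h\<partial> - f h\<close>. At the end of the block the
  inverse of \<open>r\<close> contributes the constant \<open>m\<close> and a power of \<open>q\<close> that shifts the root to the next fraction.\<close>

lemma Pop_U:
  assumes "i \<le> k"
  shows "Pop w n (U i) = smult (cst (of_nat (\<Prod>j=1..i. m j)) * qpow l (- f (i + 1)))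
           (\<Prod>j=1..i. dlin (f j) ^ u j)"
  using assms
proof (induction i)
  case 0
  then show ?case using f_first by simp
next
  case (Suc i)
  let ?c = "of_nat (\<Prod>j=1..i. m j)"
  let ?Q = "\<lambda>a. dlin (f (i + 1)) ^ a * (\<Prod>j=1..i. dlin (f j) ^ u j)"
  have qconst: "qconst l (?Q a)" for a
    by (intro qconst_mult qconst_power qconst_prod qconst_dlin)
  have lf: "of_nat l * f (i + 1) \<in> \<int>" "of_nat l * f (i + 2) \<in> \<int>"
    using l_f_Ints Suc.prems by auto
  have hdel: "hdel_left l (smult (cst ?c * qpow l (- f (i + 1))) (?Q a))
      = smult (cst ?c * qpow l (- f (i + 1))) (?Q (Suc a))" for a
    by (subst hdel_left_qpow_smult[OF lf(1) l_pos qconst]) (simp add: mult_ac)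
  \<comment> \<open>Within the block \<open>r = 1\<close>, so every step only adds a factor.\<close>
  have inner: "Pop w n (U i + a) = smult (cst ?c * qpow l (- f (i + 1))) (?Q a)"
    if "a < u (Suc i)" for a
    using that
  proof (induction a)
    case 0
    then show ?case using Suc by simp
  next
    case (Suc a)
    have "rcoef w n (Suc (U i + a)) = 1"
      using Suc.prems \<open>Suc i \<le> k\<close> by (intro rcoef_inside[of i]) (auto simp: U_Suc)
    moreover have "cinv (1 :: coef) = 1" by (rule cinv_eqI) simp
    ultimately show ?case
      using Suc hdel[of a] by (simp add: dmul_hdel)
  qed
  obtain a where a: "u (Suc i) = Suc a"
    using u_pos[of "Suc i"] Suc.prems by (cases "u (Suc i)") auto
  have U: "U (Suc i) = Suc (U i + a)"
    by (simp add: U_Suc a)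
  have "Pop w n (U (Suc i)) = smult (cinv (rcoef w n (U (Suc i)))) (hdel_left l (Pop w n (U i + a)))"
    by (simp add: U dmul_hdel)
  also have "\<dots> = smult (cinv (rcoef w n (U (Suc i))) * (cst ?c * qpow l (- f (i + 1)))) (?Q (Suc a))"
    by (simp only: inner[of a] a lessI hdel smult_smult)
  also have "cinv (rcoef w n (U (Suc i))) * (cst ?c * qpow l (- f (i + 1)))
      = (cst (of_nat (m (Suc i))) * cst ?c) * (qpow l (- f (i + 1)) * qpow l (f (i + 1) - f (i + 2)))"
    using Suc.prems by (simp add: cinv_rcoef_U mult_ac)
  also have "\<dots> = cst (of_nat (\<Prod>j=1..Suc i. m j)) * qpow l (- f (Suc i + 1))"
    using lf(1) by (simp add: qpow_add cst_mult mult_ac)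
  also have "?Q (Suc a) = (\<Prod>j=1..Suc i. dlin (f j) ^ u j)"
    by (simp add: a mult_ac)
  finally show ?case .
qed

text \<open>At the last breakpoint \<open>f\<^sub>k\<^sub>+\<^sub>1 = 1\<close>, and the closed form is \<open>q\<^sup>-\<^sup>1 T\<^sub>w\<close>. This makes the basis cyclic.\<close>

lemma Pop_s: "Pop w n s - 1 = smult (qpow l (-1)) T"
proof -
  have "qpow l (-1) * qpow l 1 = 1"
    by (subst qpow_add) auto
  then show ?thesis
    using Pop_U[of k] f_last
    by (simp add: T_eq U_k smult_diff_right mult_ac one_pCons)
qed

text \<open>Each \<open>dlin\<close> is monic, so \<open>T\<^sub>w - q\<close> has degree \<open>s\<close> and leading coefficient the product of all \<open>m\<^sub>i\<close>;
  as \<open>s > 0\<close>, subtracting \<open>q\<close> does not affect it.\<close>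

lemma T_unit: "coeff T s * cst (1 / of_nat (\<Prod>i=1..k. m i)) = 1"
  and coeff_T_above: "i > s \<Longrightarrow> coeff T i = 0"
proof -
  let ?Q = "\<lambda>i. \<Prod>j=1..i. dlin (f j) ^ u j"
  have mult: "degree (p * q) \<le> a + b \<and> coeff (p * q) (a + b) = 1"
    if "degree p \<le> a \<and> coeff p a = 1" "degree q \<le> b \<and> coeff q b = 1" for p q :: dop and a b
  proof -
    have p: "degree p = a" using that(1) le_degree[of p a] by simp
    have q: "degree q = b" using that(2) le_degree[of q b] by simp
    show ?thesis
      using degree_mult_le[of p q] coeff_mult_degree_sum[of p q] that p q by simp
  qed
  have pow: "degree (dlin x ^ a) \<le> a \<and> coeff (dlin x ^ a) a = 1" for x a
  proof (induction a)
    case (Suc a)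
    show ?case
      using mult[OF _ Suc, of "dlin x" 1] by (simp add: dlin_def)
  qed simp
  have "degree (?Q i) \<le> U i \<and> coeff (?Q i) (U i) = 1" for i
  proof (induction i)
    case (Suc i)
    show ?case
      using mult[OF Suc pow[of "f (Suc i)" "u (Suc i)"]] by (simp add: U_Suc mult_ac)
  qed simp
  from this[of k] have Q: "degree (?Q k) \<le> s" "coeff (?Q k) s = 1"
    by (simp_all add: U_k)
  have s: "s > 0" using n_less_s by simp
  have "coeff T s = cst (of_nat (\<Prod>i=1..k. m i))"
    using Q s by (simp add: T_eq coeff_pCons split: nat.split)
  moreover have "(of_nat (\<Prod>i=1..k. m i) :: complex) \<noteq> 0"
    using m_pos by (simp del: of_nat_prod)
  ultimately show "coeff T s * cst (1 / of_nat (\<Prod>i=1..k. m i)) = 1"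
    by (simp del: of_nat_prod flip: cst_mult)
  show "coeff T i = 0" if "i > s"
    using that Q by (simp add: T_eq coeff_pCons coeff_eq_0 split: nat.split)
qed

end

section \<open>Division with remainder and the dual basis\<close>

text \<open>The derivation does not raise the degree, so to leading order \<open>h\<partial>\<close> acts as a commuting variable.\<close>

lemma coeff_hdel_left_pow:
  assumes "\<And>i. i > d \<Longrightarrow> coeff Q i = 0"
  shows "coeff ((hdel_left l ^^ j) Q) (d + j) = coeff Q d"
    and "i > d + j \<Longrightarrow> coeff ((hdel_left l ^^ j) Q) i = 0"
proof -
  have "coeff ((hdel_left l ^^ j) Q) (d + j) = coeff Q d \<and>
      (\<forall>i>d + j. coeff ((hdel_left l ^^ j) Q) i = 0)"
    using assms by (induction j) (auto simp: coeff_hdel_left coeff_pCons split: nat.split)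
  then show "coeff ((hdel_left l ^^ j) Q) (d + j) = coeff Q d"
    and "i > d + j \<Longrightarrow> coeff ((hdel_left l ^^ j) Q) i = 0"
    by auto
qed

lemma dcls_eq_iff: "dcls w n P = dcls w n Q \<longleftrightarrow> (P, Q) \<in> dcong w n"
  unfolding dcls_def by (rule eq_equiv_class_iff[OF equiv_dcong UNIV_I UNIV_I])

lemma dcls_eqI: "P - Q = dmul (wlcm w n) A (Tw_minus_q w n) \<Longrightarrow> dcls w n P = dcls w n Q"
  unfolding dcls_eq_iff dcong_def by blast

lemma dcls_in_dmod [simp]: "dcls w n P \<in> dmod w n"
  by (auto simp: dcls_def dmod_def intro: quotientI)

lemma dmod_cases:
  assumes "X \<in> dmod w n"
  obtains P where "X = dcls w n P"
  using assms by (auto simp: dmod_def dcls_def elim: quotientE)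

lemma mem_dcls_iff: "Q \<in> dcls w n P \<longleftrightarrow> dcls w n Q = dcls w n P"
  using dcls_eq_iff[of w n P Q] by (auto simp: dcls_def)

lemma dcls_hdel_left_cong:
  "dcls w n P = dcls w n Q \<Longrightarrow> dcls w n (hdel_left (wlcm w n) P) = dcls w n (hdel_left (wlcm w n) Q)"
  using mact_dcls[of w n hdel P] mact_dcls[of w n hdel Q] by (simp add: dmul_hdel)

lemma dcls_smult_cong:
  "dcls w n P = dcls w n Q \<Longrightarrow> dcls w n (smult a P) = dcls w n (smult a Q)"
  using mact_dcls[of w n "[:a:]" P] mact_dcls[of w n "[:a:]" Q] by (simp add: dmul_const)

lemma dcls_add_cong:
  "dcls w n P = dcls w n P' \<Longrightarrow> dcls w n Q = dcls w n Q' \<Longrightarrow> dcls w n (P + Q) = dcls w n (P' + Q')"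
  by (metis madd_dcls)

lemma mdual_add: "\<pi> \<in> mdual w n \<Longrightarrow> \<pi> (dcls w n (P + Q)) = \<pi> (dcls w n P) + \<pi> (dcls w n Q)"
  by (simp add: mdual_def flip: madd_dcls)

lemma mdual_smult: "\<pi> \<in> mdual w n \<Longrightarrow> \<pi> (dcls w n (smult a P)) = a * \<pi> (dcls w n P)"
proof -
  assume "\<pi> \<in> mdual w n"
  moreover have "dcls w n (smult a P) = mact w n [:a:] (dcls w n P)"
    by (simp add: mact_dcls dmul_const)
  ultimately show ?thesis by (simp add: mdual_def)
qed

lemma mdual_sum: "\<pi> \<in> mdual w n \<Longrightarrow> \<pi> (dcls w n (\<Sum>x\<in>A. g x)) = (\<Sum>x\<in>A. \<pi> (dcls w n (g x)))"
proof (induction A rule: infinite_finite_induct)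
  case empty
  then show ?case using mdual_smult[of \<pi> w n 0 0] by simp
next
  case (infinite A)
  then show ?case using mdual_smult[of \<pi> w n 0 0] by simp
qed (simp add: mdual_add)

lemma mdualI:
  assumes "\<pi> \<in> extensional (dmod w n)"
    and "\<And>P Q. \<pi> (dcls w n (P + Q)) = \<pi> (dcls w n P) + \<pi> (dcls w n Q)"
    and "\<And>a P. \<pi> (dcls w n (smult a P)) = a * \<pi> (dcls w n P)"
  shows "\<pi> \<in> mdual w n"
  unfolding mdual_def using assms
  by (auto simp: PiE_def madd_dcls mact_dcls dmul_const elim!: dmod_cases)

lemma dual_ext:
  assumes "\<pi> \<in> extensional (dmod w n)" "\<pi>' \<in> extensional (dmod w n)"
    and "\<And>P. \<pi> (dcls w n P) = \<pi>' (dcls w n P)"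
  shows "\<pi> = \<pi>'"
  using assms by (intro extensionalityI[of \<pi> "dmod w n" \<pi>']) (auto elim: dmod_cases)

lemma mdual_extensional: "\<pi> \<in> mdual w n \<Longrightarrow> \<pi> \<in> extensional (dmod w n)"
  by (auto simp: mdual_def PiE_def)

context weights
begin

definition reduced :: "dop \<Rightarrow> bool" where
  "reduced R \<longleftrightarrow> (\<forall>i\<ge>s. coeff R i = 0)"

text \<open>The operators congruent to a reduced one are closed under linear combinations and under left
  multiplication by \<open>h\<partial>\<close>, since a term of order \<open>s\<close> can be cancelled by a multiple of \<open>T\<^sub>w - q\<close>.\<close>

lemma reduced_representative: "\<exists>R. reduced R \<and> dcls w n R = dcls w n P"
proof -
  have step: "\<exists>R'. reduced R' \<and> dcls w n R' = dcls w n (hdel_left l R)" if "reduced R" for R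
  proof -
    let ?c = "coeff (hdel_left l R) s * cst (1 / of_nat (\<Prod>i=1..k. m i))"
    let ?R = "hdel_left l R - smult ?c T"
    have "coeff ?R i = 0" if "i \<ge> s" for i
    proof (cases "i = s")
      case True
      have "coeff ?R s = coeff (hdel_left l R) s
          - coeff (hdel_left l R) s * (coeff T s * cst (1 / of_nat (\<Prod>i=1..k. m i)))"
        by (simp only: coeff_diff coeff_smult mult_ac)
      with True show ?thesis
        by (simp only: T_unit mult_1_right diff_self)
    next
      case False
      then show ?thesis
        using that \<open>reduced R\<close>
        by (auto simp: reduced_def coeff_T_above coeff_hdel_left coeff_pCons split: nat.split)
    qed
    moreover have "dcls w n (hdel_left l R) = dcls w n ?R"
      by (rule dcls_eqI[of _ _ _ _ "[:?c:]"]) (simp add: dmul_const)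
    ultimately show ?thesis unfolding reduced_def by metis
  qed
  have powers: "\<exists>R. reduced R \<and> dcls w n R = dcls w n (monom 1 j)" for j
  proof (induction j)
    case 0
    have "reduced 1" using n_less_s by (auto simp: reduced_def coeff_1)
    then show ?case by (auto simp: monom_0 one_pCons)
  next
    case (Suc j)
    then obtain R where "reduced R" "dcls w n R = dcls w n (monom 1 j)" by blast
    then show ?case
      using step[of R] dcls_hdel_left_cong[of w n R "monom 1 j"]
      by (simp add: hdel_left_monom_1 del: monom_Suc)
  qed
  have "\<exists>R. reduced R \<and> dcls w n R = dcls w n (\<Sum>j<d. monom (coeff P j) j)" for d
  proof (induction d)
    case 0
    show ?case by (intro exI[of _ 0]) (simp add: reduced_def)
  next
    case (Suc d)
    then obtain R where R: "reduced R" "dcls w n R = dcls w n (\<Sum>j<d. monom (coeff P j) j)"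
      by blast
    obtain R' where R': "reduced R'" "dcls w n R' = dcls w n (monom 1 d)"
      using powers by blast
    have "dcls w n (smult (coeff P d) R') = dcls w n (monom (coeff P d) d)"
      using dcls_smult_cong[OF R'(2), of "coeff P d"] by (simp add: smult_monom del: monom_Suc)
    then have "dcls w n (R + smult (coeff P d) R') = dcls w n (\<Sum>j<Suc d. monom (coeff P j) j)"
      unfolding sum.lessThan_Suc by (rule dcls_add_cong[OF R(2)])
    moreover have "reduced (R + smult (coeff P d) R')"
      using R(1) R'(1) by (simp add: reduced_def)
    ultimately show ?case by blast
  qed
  from this[of "Suc (degree P)"] show ?thesis
    unfolding lessThan_Suc_atMost poly_as_sum_of_monoms .
qed

text \<open>A nonzero multiple of \<open>T\<^sub>w - q\<close> has order at least \<open>s\<close>: its leading coefficient is that of the multiplier times a unit.\<close>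

lemma reduced_unique:
  assumes "reduced R" "reduced R'" "dcls w n R = dcls w n R'"
  shows "R = R'"
proof (rule ccontr)
  obtain A where A: "R - R' = dmul l A T"
    using assms(3) by (auto simp: dcls_eq_iff dcong_def)
  assume "R \<noteq> R'"
  then have "A \<noteq> 0" using A by auto
  let ?d = "degree A"
  have "coeff (dmul l A T) (s + ?d) = (\<Sum>j\<le>?d. coeff A j * coeff ((hdel_left l ^^ j) T) (s + ?d))"
    by (simp add: dmul_def coeff_sum)
  also have "\<dots> = (\<Sum>j\<le>?d. if j = ?d then coeff A ?d * coeff T s else 0)"
    using coeff_hdel_left_pow[where d = s and Q = T and l = l, OF coeff_T_above] by (intro sum.cong) auto
  also have "\<dots> = lead_coeff A * coeff T s"
    by simp
  finally have "lead_coeff A * coeff T s = coeff (R - R') (s + ?d)"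
    using A by simp
  also have "\<dots> = 0"
    using assms by (simp add: reduced_def)
  finally have "lead_coeff A * (coeff T s * cst (1 / of_nat (\<Prod>i=1..k. m i))) = 0"
    by (simp only: mult.assoc[symmetric] mult_zero_left)
  then show False
    using \<open>A \<noteq> 0\<close> by (simp only: T_unit mult_1_right leading_coeff_0_iff)
qed

text \<open>Taking the \<open>i\<close>-th coefficient of the remainder modulo \<open>T\<^sub>w - q\<close> (zero for \<open>i \<ge> s\<close>) is a functional
  with the values that define \<open>ddual\<close>, and these values determine it, since the powers of \<open>h\<partial>\<close> below \<open>s\<close> span the module.\<close>

lemma ddual:
  shows ddual_mdual: "ddual w n i \<in> mdual w n"
    and ddual_reduced: "reduced R \<Longrightarrow> i < s \<Longrightarrow> ddual w n i (dcls w n R) = coeff R i"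
proof -
  define rem where "rem X = (THE R. reduced R \<and> dcls w n R = X)" for X
  have rem_eqI: "rem (dcls w n P) = R" if "reduced R" "dcls w n R = dcls w n P" for P R
    unfolding rem_def using that by (intro the_equality) (auto intro: reduced_unique)
  have rem: "reduced (rem (dcls w n P)) \<and> dcls w n (rem (dcls w n P)) = dcls w n P" for P
    using reduced_representative[of P] rem_eqI by metis
  define \<delta> where "\<delta> = (\<lambda>X\<in>dmod w n. if i < s then coeff (rem X) i else 0)"
  have \<delta>: "\<delta> \<in> mdual w n"
  proof (rule mdualI)
    show "\<delta> (dcls w n (P + Q)) = \<delta> (dcls w n P) + \<delta> (dcls w n Q)" for P Q
    proof -
      have "rem (dcls w n (P + Q)) = rem (dcls w n P) + rem (dcls w n Q)"
        using rem by (intro rem_eqI dcls_add_cong) (auto simp: reduced_def)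
      then show ?thesis by (simp add: \<delta>_def)
    qed
    show "\<delta> (dcls w n (smult a P)) = a * \<delta> (dcls w n P)" for a P
    proof -
      have "rem (dcls w n (smult a P)) = smult a (rem (dcls w n P))"
        using rem by (intro rem_eqI dcls_smult_cong) (auto simp: reduced_def)
      then show ?thesis by (simp add: \<delta>_def)
    qed
  qed (simp add: \<delta>_def)
  let ?dual = "\<lambda>\<pi>. \<pi> \<in> mdual w n \<and>
     (\<forall>j<s. \<pi> (dcls w n (monom 1 j)) = (if j = i then 1 else 0))"
  have reduced_monom: "reduced (monom 1 j)" if "j < s" for j
    using that by (auto simp: reduced_def)
  have "?dual \<delta>"
    using \<delta> rem_eqI[OF reduced_monom refl] by (auto simp: \<delta>_def)
  have val: "\<pi> (dcls w n R) = (if i < s then coeff R i else 0)"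
    if "?dual \<pi>" "reduced R" for \<pi> R
  proof -
    have "R = (\<Sum>j<s. smult (coeff R j) (monom 1 j))"
    proof (rule poly_eqI)
      fix i
      have "coeff (\<Sum>j<s. smult (coeff R j) (monom 1 j)) i = (\<Sum>j<s. if j = i then coeff R i else 0)"
        unfolding coeff_sum by (rule sum.cong) auto
      also have "\<dots> = coeff R i"
        using that(2) by (auto simp: reduced_def)
      finally show "coeff R i = coeff (\<Sum>j<s. smult (coeff R j) (monom 1 j)) i" ..
    qed
    then have "\<pi> (dcls w n R) = \<pi> (dcls w n (\<Sum>j<s. smult (coeff R j) (monom 1 j)))"
      by (rule arg_cong)
    also have "\<dots> = (\<Sum>j<s. if j = i then coeff R i else 0)"
      unfolding mdual_sum[OF conjunct1[OF that(1)]]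
      by (rule sum.cong) (use that(1) in \<open>auto simp: mdual_smult\<close>)
    finally show ?thesis by auto
  qed
  have unique: "\<pi> = \<delta>" if "?dual \<pi>" for \<pi>
  proof (rule dual_ext)
    fix P
    show "\<pi> (dcls w n P) = \<delta> (dcls w n P)"
      using val[OF that, of "rem (dcls w n P)"] val[OF \<open>?dual \<delta>\<close>, of "rem (dcls w n P)"] rem[of P]
      by simp
  qed (use that \<delta> mdual_extensional in blast)+
  have "ddual w n i = \<delta>"
    unfolding ddual_def using \<open>?dual \<delta>\<close> unique by (rule the_equality)
  then show "ddual w n i \<in> mdual w n"
    and "reduced R \<Longrightarrow> i < s \<Longrightarrow> ddual w n i (dcls w n R) = coeff R i"
    using \<delta> val[OF \<open>?dual \<delta>\<close>] by simp_all
qed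

end

section \<open>The action on the dual\<close>

lemma odot_hdel_dcls:
  "odot_hdel w n \<pi> (dcls w n P) =
     \<pi> (dcls w n (hdel_left (wlcm w n) P)) - hbar * qderiv (wlcm w n) (\<pi> (dcls w n P))"
  by (simp add: odot_hdel_def mact_dcls dmul_hdel)

text \<open>The correction term of the dual action cancels the derivative of the coefficient that \<open>h\<partial>\<close> produces on the module.\<close>

lemma odot_hdel_mdual: "\<pi> \<in> mdual w n \<Longrightarrow> odot_hdel w n \<pi> \<in> mdual w n"
proof (rule mdualI)
  show "odot_hdel w n \<pi> \<in> extensional (dmod w n)"
    by (simp add: odot_hdel_def)
qed (simp_all add: odot_hdel_dcls hdel_left_add hdel_left_smult mdual_add mdual_smult
    qderiv_add qderiv_mult algebra_simps)

lemma odot_extensional [simp]: "odot w n P \<pi> \<in> extensional (dmod w n)"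
  by (simp add: odot_def)

lemma odot_dcls:
  assumes "degree P \<le> N"
  shows "odot w n P \<pi> (dcls w n Q) =
    (\<Sum>j\<le>N. reflect (coeff P j) * (odot_hdel w n ^^ j) \<pi> (dcls w n Q))"
proof -
  have "(\<Sum>j\<le>degree P. reflect (coeff P j) * (odot_hdel w n ^^ j) \<pi> (dcls w n Q)) =
      (\<Sum>j\<le>N. reflect (coeff P j) * (odot_hdel w n ^^ j) \<pi> (dcls w n Q))"
    by (rule sum.mono_neutral_left) (use assms in \<open>simp_all add: coeff_eq_0\<close>)
  then show ?thesis
    by (simp add: odot_def)
qed

lemma odot_mdual:
  assumes "\<pi> \<in> mdual w n"
  shows "odot w n P \<pi> \<in> mdual w n"
proof (rule mdualI)
  have *: "(odot_hdel w n ^^ j) \<pi> \<in> mdual w n" for j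
    by (induction j) (auto simp: assms odot_hdel_mdual)
  show "odot w n P \<pi> (dcls w n (Q + R)) = odot w n P \<pi> (dcls w n Q) + odot w n P \<pi> (dcls w n R)" for Q R
    by (simp add: odot_dcls[OF order_refl] mdual_add[OF *] sum.distrib distrib_left)
  show "odot w n P \<pi> (dcls w n (smult a Q)) = a * odot w n P \<pi> (dcls w n Q)" for a Q
    by (simp add: odot_dcls[OF order_refl] mdual_smult[OF *] sum_distrib_left mult_ac)
qed simp

lemma odot_add:
  "odot w n (P + P') \<pi> (dcls w n Q) = odot w n P \<pi> (dcls w n Q) + odot w n P' \<pi> (dcls w n Q)"
proof -
  define N where "N = max (degree P) (degree P')"
  have "degree (P + P') \<le> N" "degree P \<le> N" "degree P' \<le> N"
    by (auto simp: N_def degree_add_le_max)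
  then show ?thesis
    by (simp add: odot_dcls[where N = N] reflect_add sum.distrib distrib_right)
qed

lemma odot_smult: "odot w n (smult a P) \<pi> (dcls w n Q) = reflect a * odot w n P \<pi> (dcls w n Q)"
proof -
  have "degree (smult a P) \<le> degree P"
    by (rule degree_smult_le)
  then show ?thesis
    by (simp add: odot_dcls[where N = "degree P"] reflect_mult sum_distrib_left mult_ac)
qed

lemma odot_1: "odot w n 1 \<pi> (dcls w n Q) = \<pi> (dcls w n Q)"
  by (simp add: odot_dcls[where N = 0])

text \<open>Compatibility of the dual action with the operator product. The sign in \<open>reflect hbar = - hbar\<close> matches
  the minus sign of the derivative term of the dual action.\<close>

lemma odot_hdel_left:
  "odot w n (hdel_left (wlcm w n) P) \<pi> (dcls w n Q) = odot_hdel w n (odot w n P \<pi>) (dcls w n Q)"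
proof -
  let ?l = "wlcm w n" and ?N = "degree P"
  let ?e = "\<lambda>j. (odot_hdel w n ^^ j) \<pi>"
  let ?c = "\<lambda>j. reflect (coeff P j)"
  have deg: "degree (hdel_left ?l P) \<le> Suc ?N"
    by (rule degree_le) (auto simp: coeff_hdel_left coeff_pCons coeff_eq_0 split: nat.split)
  have "odot_hdel w n (odot w n P \<pi>) (dcls w n Q) =
      (\<Sum>j\<le>?N. ?c j * ?e j (dcls w n (hdel_left ?l Q)))
      - hbar * qderiv ?l (\<Sum>j\<le>?N. ?c j * ?e j (dcls w n Q))"
    by (simp add: odot_hdel_dcls odot_dcls[OF order_refl])
  also have "\<dots> = (\<Sum>j\<le>?N. ?c j * ?e (Suc j) (dcls w n Q))
      - (\<Sum>j\<le>?N. hbar * qderiv ?l (?c j) * ?e j (dcls w n Q))"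
    by (simp add: qderiv_sum qderiv_mult sum_distrib_left odot_hdel_dcls sum.distrib
        right_diff_distrib distrib_left sum_subtractf mult_ac)
  also have "\<dots> = (\<Sum>j\<le>Suc ?N. reflect (coeff (pCons 0 P) j) * ?e j (dcls w n Q))
      - (\<Sum>j\<le>Suc ?N. hbar * qderiv ?l (?c j) * ?e j (dcls w n Q))"
    by (simp add: sum.atMost_Suc_shift[of "\<lambda>j. reflect (coeff (pCons 0 P) j) * ?e j (dcls w n Q)"]
        coeff_eq_0 del: sum.atMost_Suc) (simp add: coeff_eq_0)
  also have "\<dots> = odot w n (hdel_left ?l P) \<pi> (dcls w n Q)"
    by (simp add: odot_dcls[OF deg] coeff_hdel_left reflect_add reflect_mult reflect_qderiv
        distrib_right left_diff_distrib sum.distrib sum_subtractf sum_negf del: sum.atMost_Suc)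
  finally show ?thesis ..
qed

text \<open>The annihilator of a functional is a left ideal.\<close>

lemma odot_dmul_eq_0:
  assumes "\<And>P. odot w n Q \<pi> (dcls w n P) = 0"
  shows "odot w n (dmul (wlcm w n) A Q) \<pi> (dcls w n P) = 0"
  using assms
proof (induction A arbitrary: Q)
  case 0
  show ?case by (simp add: odot_dcls[where N = 0])
next
  case (pCons a A)
  have "odot w n (hdel_left (wlcm w n) Q) \<pi> (dcls w n P) = 0" for P
    by (simp add: odot_hdel_left odot_hdel_dcls pCons.prems)
  then show ?case
    by (simp add: dmul_pCons odot_add odot_smult pCons)
qed

section \<open>The pairing\<close>

context weights
begin

abbreviation "e a \<equiv> odot w n (Pop w n a) (ddual w n n)"

lemma hdel_left_Pop: "hdel_left l (Pop w n a) = smult (rcoef w n (Suc a)) (Pop w n (Suc a))"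
  using rcoef_unit[of "Suc a"] by (simp add: dmul_hdel)

lemma dcls_Pop_s: "dcls w n (Pop w n s) = dcls w n (Pop w n 0)"
  by (rule dcls_eqI[of _ _ _ _ "[:qpow l (-1):]"]) (simp add: Pop_s dmul_const)

lemma e_mdual: "e a \<in> mdual w n"
  by (intro odot_mdual ddual_mdual)

text \<open>Adjointness of \<open>h\<partial>\<close> on the module and on its dual, written in the basis on which \<open>h\<partial>\<close> acts as a weighted shift.\<close>

lemma e_Suc:
  "rcoef w n (Suc a) * e (Suc a) (dcls w n (Pop w n b)) =
     rcoef w n (Suc b) * e a (dcls w n (Pop w n (Suc b)))
     - hbar * qderiv l (e a (dcls w n (Pop w n b)))"
proof -
  have "rcoef w n (Suc a) * e (Suc a) (dcls w n (Pop w n b)) =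
      odot w n (hdel_left l (Pop w n a)) (ddual w n n) (dcls w n (Pop w n b))"
    by (simp only: hdel_left_Pop odot_smult reflect_rcoef)
  also have "\<dots> = e a (dcls w n (hdel_left l (Pop w n b))) - hbar * qderiv l (e a (dcls w n (Pop w n b)))"
    by (simp only: odot_hdel_left odot_hdel_dcls)
  finally show ?thesis
    by (simp only: hdel_left_Pop mdual_smult[OF e_mdual])
qed

text \<open>The first \<open>n + 1\<close> basis elements are the powers of \<open>h\<partial>\<close>, because \<open>r\<close> is \<open>1\<close> below the first breakpoint
  \<open>n + 1\<close>. From then on only powers above \<open>n\<close> occur, which \<open>\<delta>\<^sub>n\<close> does not see.\<close>

lemma e_0_Pop:
  assumes "b < s"
  shows "e 0 (dcls w n (Pop w n b)) = (if b = n then 1 else 0)"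
proof -
  have low: "Pop w n b = monom 1 b" if "b \<le> n" for b
    using that
  proof (induction b)
    case (Suc b)
    have "rcoef w n (Suc b) = 1"
      using Suc.prems by (intro rcoef_inside[of 0]) (auto simp: U_1[unfolded One_nat_def])
    moreover have "cinv (1 :: coef) = 1" by (rule cinv_eqI) simp
    ultimately show ?case
      using Suc by (simp add: dmul_hdel hdel_left_monom_1 del: monom_Suc)
  qed (simp add: monom_0 one_pCons)
  have high: "coeff (Pop w n (Suc (n + a))) i = 0" if "i \<le> n" for a i
    using that
  proof (induction a arbitrary: i)
    case 0
    then show ?case
      by (simp add: low dmul_hdel hdel_left_monom_1 del: monom_Suc)
  next
    case (Suc a)
    have "coeff (Pop w n (Suc b)) i = cinv (rcoef w n (Suc b)) *
        (coeff (pCons 0 (Pop w n b)) i + hbar * qderiv l (coeff (Pop w n b) i))" for b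
      by (simp add: dmul_hdel coeff_hdel_left)
    from this[of "Suc (n + a)"] show ?case
      using Suc by (simp add: coeff_pCons del: Pop.simps split: nat.splits)
  qed
  have deg: "degree (Pop w n b) \<le> b" for b
  proof (induction b)
    case (Suc b)
    then show ?case
      by (intro degree_le) (auto simp: dmul_hdel coeff_hdel_left coeff_pCons coeff_eq_0 split: nat.split)
  qed simp
  have "reduced (Pop w n b)"
    using deg[of b] assms by (auto simp: reduced_def intro!: coeff_eq_0)
  then have "e 0 (dcls w n (Pop w n b)) = coeff (Pop w n b) n"
    using n_less_s by (simp add: odot_1 ddual_reduced)
  also have "\<dots> = (if b = n then 1 else 0)"
    using low[of b] high[of n "b - Suc n"] by (cases "b \<le> n") auto
  finally show ?thesis .
qed

text \<open>The reflection \<open>a \<mapsto> s + n + 1 - a\<close> maps breakpoints to breakpoints, hence the interior of a block to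
  the interior of a block. If \<open>a + b + 2 = n + 1\<close>, both indices lie below the first breakpoint.\<close>

lemma rcoef_reciprocity:
  assumes "i \<le> k" "U i \<le> a" "Suc a < U (Suc i)"
    and "a + b + 2 = n + 1 \<or> a + b + 2 = s + n + 1"
    and "a < s" "b < s"
  shows "rcoef w n (Suc a) = 1 \<and> rcoef w n (Suc b) = 1"
proof
  show "rcoef w n (Suc a) = 1"
    using assms by (intro rcoef_inside[of i]) auto
  show "rcoef w n (Suc b) = 1"
  proof (cases "a + b + 2 = n + 1")
    case True
    then show ?thesis
      by (intro rcoef_inside[of 0]) (auto simp: U_1[unfolded One_nat_def])
  next
    case False
    then have "a + b + 2 = s + n + 1" using assms(4) by simp
    moreover have "U i + U (Suc (k - i)) = s + n + 1"
      using U_reflect[of i] assms(1) by (simp add: Suc_diff_le)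
    moreover have "U (Suc i) + U (k - i) = s + n + 1"
      using U_reflect[of "Suc i"] assms(1) by simp
    ultimately show ?thesis
      using assms(2,3) by (intro rcoef_inside[of "k - i"]) linarith+
  qed
qed

text \<open>Induction on the row \<open>a\<close>. All values are constants, so the derivative in \<open>e_Suc\<close> vanishes and the
  support moves one step along the antidiagonal, where the column \<open>s\<close> is the column \<open>0\<close>. The row \<open>a = s\<close>
  is included, lying in the block of \<open>f\<^sub>k\<^sub>+\<^sub>1 = 1\<close>.\<close>

lemma e_Pop:
  assumes "a \<le> s" "i \<le> k" "U i \<le> a" "a < U (Suc i)" "b < s"
  shows "e a (dcls w n (Pop w n b)) =
    (if a + b = n \<or> a + b = s + n then cst (of_nat (m 1) / of_nat (m (Suc i))) else 0)"
  using assms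
proof (induction a arbitrary: i b)
  case 0
  have "i = 0"
    using 0 U_mono[of 1 i] U_1 by (cases i) auto
  then show ?case
    using 0 e_0_Pop[of b] m_pos[of 1] n_less_s by auto
next
  case (Suc a)
  define c where "c i = cst (of_nat (m 1) / of_nat (m (Suc i)))" for i
  \<comment> \<open>The block of the previous row: the same one, unless \<open>Suc a\<close> is a breakpoint.\<close>
  obtain i' where i': "i' \<le> k" "U i' \<le> a" "a < U (Suc i')"
    and i'_cases: "i' = i \<and> U i \<le> a \<or> i = Suc i' \<and> Suc a = U i"
  proof (cases "U i \<le> a")
    case False
    then have "Suc a = U i" using Suc.prems by simp
    moreover from this have "i \<noteq> 0" by (cases i) simp_all
    ultimately obtain i' where "Suc a = U i" "i = Suc i'" by (cases i) simp_all
    then have "U i' \<le> a"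
      using \<open>Suc a = U i\<close> U_strict_mono[of i' i] Suc.prems by simp
    then show ?thesis
      using that[of i'] \<open>i = Suc i'\<close> \<open>Suc a = U i\<close> Suc.prems by simp
  qed (use Suc.prems in auto)
  have IH: "e a (dcls w n (Pop w n b)) = (if a + b = n \<or> a + b = s + n then c i' else 0)"
    if "b < s" for b
    using Suc.IH[of i' b] Suc.prems that i' by (simp add: c_def)
  have deriv: "qderiv l (e a (dcls w n (Pop w n b))) = 0"
    using IH[of b] Suc.prems by (simp add: c_def)
  have next': "e a (dcls w n (Pop w n (Suc b))) =
      (if Suc a + b = n \<or> Suc a + b = s + n then c i' else 0)"
  proof (cases "Suc b < s")
    case True
    then show ?thesis using IH[of "Suc b"] by simp
  next
    case False
    then have b: "Suc b = s" using Suc.prems by simp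
    then have "e a (dcls w n (Pop w n (Suc b))) = e a (dcls w n (Pop w n 0))"
      by (simp only: dcls_Pop_s)
    also have "\<dots> = (if a = n \<or> a = s + n then c i' else 0)"
      using IH[of 0] n_less_s by simp
    finally show ?thesis using b Suc.prems n_less_s by auto
  qed
  \<comment> \<open>Reciprocity: the two jumps of \<open>r\<close> have the same power of \<open>q\<close> and compensate \<open>c i' / c i\<close>.\<close>
  have recip: "rcoef w n (Suc b) * c i' = rcoef w n (Suc a) * c i"
    if ab: "Suc a + b = n \<or> Suc a + b = s + n"
    using i'_cases
  proof
    assume "i' = i \<and> U i \<le> a"
    moreover from this have "rcoef w n (Suc a) = 1 \<and> rcoef w n (Suc b) = 1"
      using Suc.prems ab by (intro rcoef_reciprocity[of i]) auto
    ultimately show ?thesis by simp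
  next
    assume i: "i = Suc i' \<and> Suc a = U i"
    \<comment> \<open>A breakpoint is at least \<open>n + 1\<close>, which excludes the antidiagonal \<open>Suc a + b = n\<close>.\<close>
    have "U 1 \<le> U i" using i Suc.prems by (intro U_mono) auto
    then have "Suc a + b = s + n" using ab i U_1 by auto
    then have "Suc b = U (k + 1 - i)"
      using U_reflect[of i] i Suc.prems by simp
    then have "rcoef w n (Suc b) = cst (1 / of_nat (m (k + 1 - i))) * qpow l (fdelta w n (k + 1 - i))"
      using i Suc.prems by (simp only:) (rule rcoef_U, auto)
    also have "m (k + 1 - i) = m (Suc i)"
      using m_symmetric[of "Suc i"] i Suc.prems by simp
    also have "fdelta w n (k + 1 - i) = fdelta w n i"
      using i Suc.prems by (intro fdelta_symmetric) auto
    finally have b: "rcoef w n (Suc b) = cst (1 / of_nat (m (Suc i))) * qpow l (fdelta w n i)" .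
    have a: "rcoef w n (Suc a) = cst (1 / of_nat (m i)) * qpow l (fdelta w n i)"
      using i Suc.prems rcoef_U[of i] by simp
    have c: "cst (1 / of_nat (m (Suc i))) * c i' = cst (1 / of_nat (m i)) * c i"
      using i by (simp add: c_def mult.commute flip: cst_mult)
    have "rcoef w n (Suc b) * c i' = qpow l (fdelta w n i) * (cst (1 / of_nat (m (Suc i))) * c i')"
      by (simp only: b mult_ac)
    also have "\<dots> = rcoef w n (Suc a) * c i"
      unfolding c by (simp only: a mult_ac)
    finally show ?thesis .
  qed
  have "rcoef w n (Suc a) * e (Suc a) (dcls w n (Pop w n b)) =
      rcoef w n (Suc b) * (if Suc a + b = n \<or> Suc a + b = s + n then c i' else 0)"
    by (simp only: e_Suc next' deriv) simp
  also have "\<dots> = rcoef w n (Suc a) * (if Suc a + b = n \<or> Suc a + b = s + n then c i else 0)"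
    using recip by simp
  finally show ?case
    unfolding c_def by (rule rcoef_cancel)
qed

text \<open>The rows \<open>s\<close> and \<open>0\<close> agree on the basis \<open>P\<^sub>0, \<dots>, P\<^sub>s\<^sub>-\<^sub>1\<close>. This suffices, as the span of the basis is
  closed under \<open>h\<partial>\<close> by cyclicity and contains \<open>1\<close>.\<close>

lemma e_s: "e s (dcls w n P) = e 0 (dcls w n P)"
proof -
  define \<epsilon> where "\<epsilon> P = e s (dcls w n P) - e 0 (dcls w n P)" for P
  have \<epsilon>_add: "\<epsilon> (P + Q) = \<epsilon> P + \<epsilon> Q" for P Q
    by (simp add: \<epsilon>_def mdual_add[OF e_mdual] del: Pop.simps)
  have \<epsilon>_smult: "\<epsilon> (smult a P) = a * \<epsilon> P" for a P
    by (simp add: \<epsilon>_def mdual_smult[OF e_mdual] right_diff_distrib del: Pop.simps)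
  have U: "s < U (Suc k)"
    using U_strict_mono[of k "Suc k"] U_k by simp
  have m: "m (Suc k) = m 1"
    using m_symmetric[of 1] k_pos by simp
  have \<epsilon>_Pop: "\<epsilon> (Pop w n b) = 0" if "b < s" for b
    using e_Pop[of s k b] e_0_Pop[of b] that U U_k m m_pos[of 1] n_less_s
    by (simp add: \<epsilon>_def del: Pop.simps)
  have pow: "\<epsilon> ((hdel_left l ^^ j) (smult a (Pop w n b))) = 0" if "b < s" for j a b
    using that
  proof (induction j arbitrary: a b)
    case 0
    then show ?case by (simp add: \<epsilon>_smult \<epsilon>_Pop)
  next
    case (Suc j)
    let ?a = "a * rcoef w n (Suc b)"
    have next': "\<epsilon> ((hdel_left l ^^ j) (smult ?a (Pop w n (Suc b)))) = 0"
    proof (cases "Suc b < s")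
      case True
      then show ?thesis by (rule Suc.IH)
    next
      case False
      then have "Suc b = s" using Suc.prems by simp
      then have *: "dcls w n (Pop w n (Suc b)) = dcls w n (Pop w n 0)"
        by (simp only: dcls_Pop_s)
      have "dcls w n ((hdel_left l ^^ j) (smult ?a (Pop w n (Suc b)))) =
          dcls w n ((hdel_left l ^^ j) (smult ?a (Pop w n 0)))"
      proof (induction j)
        case 0
        show ?case using dcls_smult_cong[OF *] by (simp only: funpow.simps id_apply)
      next
        case (Suc j)
        then show ?case using dcls_hdel_left_cong[OF Suc] by (simp only: funpow.simps o_apply)
      qed
      then show ?thesis
        using Suc.IH[of 0 ?a] Suc.prems by (simp add: \<epsilon>_def del: Pop.simps)
    qed
    have "(hdel_left l ^^ Suc j) (smult a (Pop w n b)) =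
        (hdel_left l ^^ j) (smult ?a (Pop w n (Suc b))) +
        (hdel_left l ^^ j) (smult (hbar * qderiv l a) (Pop w n b))"
      by (simp only: funpow_Suc_right o_def hdel_left_smult hdel_left_Pop smult_smult hdel_left_pow_add)
    then show ?case
      using next' Suc.IH[OF Suc.prems] by (simp only: \<epsilon>_add) simp
  qed
  have \<epsilon>_sum: "\<epsilon> (\<Sum>j\<in>A. g j) = (\<Sum>j\<in>A. \<epsilon> (g j))" for g :: "nat \<Rightarrow> dop" and A
    by (simp add: \<epsilon>_def mdual_sum[OF e_mdual] sum_subtractf del: Pop.simps)
  have "\<epsilon> P = \<epsilon> (dmul l P 1)"
    by simp
  also have "\<dots> = 0"
    using pow[of 0 _ 1] n_less_s by (simp add: dmul_def \<epsilon>_sum \<epsilon>_smult one_pCons)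
  finally show ?thesis
    by (simp add: \<epsilon>_def)
qed

lemma odot_T: "odot w n T (ddual w n n) (dcls w n P) = 0"
proof -
  have "qpow l 1 * qpow l (-1) = 1"
    by (subst qpow_add) auto
  then have "T = smult (qpow l 1) (Pop w n s - 1)"
    by (simp add: Pop_s)
  also have "\<dots> = smult (qpow l 1) (Pop w n s + smult (cst (-1)) (Pop w n 0))"
    by (simp only: Pop.simps cst_minus cst_1 smult_minus_left smult_1_left diff_conv_add_uminus)
  finally have "odot w n T (ddual w n n) (dcls w n P) =
      qpow l 1 * (e s (dcls w n P) + cst (-1) * e 0 (dcls w n P))"
    by (simp only: odot_smult odot_add reflect_qpow reflect_cst)
  then show ?thesis
    by (simp only: e_s) (simp add: cst_minus)
qed

text \<open>The annihilator of \<open>\<delta>\<^sub>n\<close> contains the left ideal of \<open>T\<^sub>w - q\<close>, so the set whose single element defines \<open>to_dual\<close> is indeed a singleton.\<close>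

lemma to_dual_dcls: "to_dual w n (dcls w n P) = odot w n P (ddual w n n)"
proof -
  have "odot w n Q (ddual w n n) = odot w n P (ddual w n n)" if "Q \<in> dcls w n P" for Q
  proof -
    obtain A where A: "Q - P = dmul l A T"
      using \<open>Q \<in> dcls w n P\<close> by (auto simp: mem_dcls_iff dcls_eq_iff dcong_def)
    have "odot w n Q (ddual w n n) (dcls w n R) = odot w n P (ddual w n n) (dcls w n R)" for R
    proof -
      have "odot w n Q (ddual w n n) (dcls w n R) = odot w n (dmul l A T + P) (ddual w n n) (dcls w n R)"
        by (simp flip: A)
      then show ?thesis
        by (simp add: odot_add odot_dmul_eq_0[OF odot_T])
    qed
    then show ?thesis
      by (intro dual_ext) auto
  qed
  then have "(\<lambda>P. odot w n P (ddual w n n)) ` dcls w n P = (\<lambda>_. odot w n P (ddual w n n)) ` dcls w n P"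
    by (rule image_cong[OF refl])
  also have "\<dots> = {odot w n P (ddual w n n)}"
    by (rule image_constant[of P]) (simp add: mem_dcls_iff)
  finally have "(\<lambda>P. odot w n P (ddual w n n)) ` dcls w n P = {odot w n P (ddual w n n)}" .
  then show ?thesis
    by (simp add: to_dual_def)
qed

lemma pairing_Pbasis:
  assumes "a < s" "b < s" "i \<le> k" "U i \<le> a" "a < U (Suc i)"
  shows "pairing w n (Pbasis w n a) (Pbasis w n b) =
    (if a + b = n \<or> a + b = s + n then cst (1 / of_nat (m (i + 1))) else 0)"
proof -
  have "cst (1 / of_nat (m 1)) * cst (of_nat (m 1) / of_nat (m (Suc i))) = cst (1 / of_nat (m (Suc i)))"
    using m_pos[of 1] by (simp flip: cst_mult)
  then show ?thesis
    using assms e_Pop[of a i b]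
    by (simp add: pairing_def Pbasis_def to_dual_dcls flip: m_first del: of_nat_prod)
qed

end

theorem corollary4p3:
  fixes w :: "nat \<Rightarrow> nat" and n :: nat and \<alpha> \<beta> :: nat
  assumes w_pos: "\<And>j. j \<le> n \<Longrightarrow> w j > 0"
    and \<alpha>: "\<alpha> \<le> wsum w n - 1"
    and \<beta>: "\<beta> \<le> wsum w n - 1"
  shows "(\<alpha> < umult w n 1 \<longrightarrow>
      pairing w n (Pbasis w n \<alpha>) (Pbasis w n \<beta>) =
        cst (1 / of_nat (mprod w n 1)) * kron (int n - int \<alpha>) (int \<beta>)) \<and>
    (\<forall>i. 1 \<le> i \<and> i + 1 \<le> knum w n \<and>
        (\<Sum>j=1..i. umult w n j) \<le> \<alpha> \<and> \<alpha> < (\<Sum>j=1..i+1. umult w n j) \<longrightarrow>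
      pairing w n (Pbasis w n \<alpha>) (Pbasis w n \<beta>) =
        cst (1 / of_nat (mprod w n (i + 1))) * kron (int (wsum w n) + int n - int \<alpha>) (int \<beta>))"
proof -
  interpret weights w n
    using w_pos by unfold_locales
  have \<alpha>': "\<alpha> < s" and \<beta>': "\<beta> < s"
    using \<alpha> \<beta> n_less_s by auto
  show ?thesis
    unfolding U_def[symmetric]
  proof (intro conjI allI impI)
    assume "\<alpha> < u 1"
    then have "\<alpha> \<le> n" and "\<alpha> < U (Suc 0)"
      using u_first U_1 by auto
    then show "pairing w n (Pbasis w n \<alpha>) (Pbasis w n \<beta>) =
        cst (1 / of_nat (m 1)) * kron (int n - int \<alpha>) (int \<beta>)"
      using pairing_Pbasis[OF \<alpha>' \<beta>', of 0] \<beta>' by (auto simp: kron_def)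
  next
    fix i assume i: "1 \<le> i \<and> i + 1 \<le> k \<and> U i \<le> \<alpha> \<and> \<alpha> < U (i + 1)"
    then have "n < \<alpha>"
      using U_mono[of 1 i] U_1 by simp
    then show "pairing w n (Pbasis w n \<alpha>) (Pbasis w n \<beta>) =
        cst (1 / of_nat (m (i + 1))) * kron (int s + int n - int \<alpha>) (int \<beta>)"
      using pairing_Pbasis[OF \<alpha>' \<beta>', of i] i by (auto simp: kron_def)
  qed
qed

end
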